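(* Let $a\in\widetilde{\mathcal A}_0'(\mathbf C^d\times\mathbf C^d)$ and let $s\in\overline{\mathbf R_\flat}$ be such that $s<\frac12$. If $a\in\widetilde{\mathcal A}_s'(\mathbf C^d\times\mathbf C^d)$, then $\operatorname{Op}_{\mathfrak V}(a)$ (from $\mathcal A_0(\mathbf C^d)$ to $\mathcal A_0'(\mathbf C^d)$) extends uniquely to a linear and continuous map from $\mathcal A_s(\mathbf C^d)$ to $\mathcal A_s'(\mathbf C^d)$. The same holds true if the condition $s\in\overline{\mathbf R_\flat}$, $s<\frac12$, and the spaces $\mathcal A_s$, $\mathcal A_s'$ and $\widetilde{\mathcal A}_s'$ are replaced by $s\in\mathbf R_\flat$, $s\le\frac12$, and $\mathcal A_{0,s}$, $\mathcal A_{0,s}'$ and $\widetilde{\mathcal A}_{0,s}'$, respectively, at each occurrence.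
   Context: Index sets: $\mathbf N=\{0,1,2,\dots\}$; $\mathbf R_\flat=\mathbf R_+\cup\{\flat_\sigma : \sigma>0\}$ with formal symbols $\flat_\sigma$, and $\overline{\mathbf R_\flat}=\mathbf R_\flat\cup\{0\}$. The order extends the usual order on $[0,\infty)$ by $x_1<\flat_{\sigma_1}<\flat_{\sigma_2}<x_2$ whenever $0\le x_1<\frac12\le x_2$ and $0<\sigma_1<\sigma_2$. Sequence spaces: for $s\in\mathbf R_\flat$, $r>0$, $\alpha\in\mathbf N^n$ let $\vartheta_{r,s}(\alpha)=e^{r|\alpha|^{1/(2s)}}$ if $s\in\mathbf R_+$ and $\vartheta_{r,s}(\alpha)=r^{|\alpha|}(\alpha!)^{1/(2\sigma)}$ if $s=\flat_\sigma$. Let $\ell^p_{[\vartheta]}(\mathbf N^n)$ be the Banach space of complex sequences $c$ with $\|c\,\vartheta\|_{\ell^p}<\infty$; fix any $p\in[1,\infty]$ (the spaces below do not depend on it). For $s\in\mathbf R_\flat$: $\ell_{0,s}=\bigcap_{r>0}\ell^p_{[\vartheta_{r,s}]}$ and $\ell_s'=\bigcap_{r>0}\ell^p_{[1/\vartheta_{r,s}]}$ with projective limit topologies; $\ell_s=\bigcup_{r>0}\ell^p_{[\vartheta_{r,s}]}$ and $\ell_{0,s}'=\bigcup_{r>0}\ell^p_{[1/\vartheta_{r,s}]}$ with inductive limit topologies. $\ell_0'(\mathbf N^n)$ is the space of all complex sequences with the topology of the seminorms $c\mapsto\|\{c_\alpha\}_{|\alpha|\le N}\|_{\ell^p}$;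 $\ell_0(\mathbf N^n)$ is the space of finitely supported sequences with the inductive limit topology of the spaces $\{c : c_\alpha=0\text{ for }|\alpha|>N\}$. Power series spaces: $e_\alpha(z)=z^\alpha/\sqrt{\alpha!}$. $\mathcal A_{0,s}(\mathbf C^d)$, $\mathcal A_s(\mathbf C^d)$, $\mathcal A_s'(\mathbf C^d)$, $\mathcal A_{0,s}'(\mathbf C^d)$ consist of all formal power series $F=\sum_\alpha c(F,\alpha)e_\alpha$ with coefficients in $\ell_{0,s}(\mathbf N^d)$, $\ell_s(\mathbf N^d)$, $\ell_s'(\mathbf N^d)$, $\ell_{0,s}'(\mathbf N^d)$ respectively, with transported topologies. $\widetilde{\mathcal A}_s'(\mathbf C^d\times\mathbf C^d)$ and $\widetilde{\mathcal A}_{0,s}'(\mathbf C^d\times\mathbf C^d)$ consist of all formal series $a(z,w)=\sum_{\alpha,\beta\in\mathbf N^d}c_a(\alpha,\beta)e_\alpha(z)e_\beta(\overline w)$ with $c_a$ in $\ell_s'(\mathbf N^{2d})$ and $\ell_{0,s}'(\mathbf N^{2d})$ respectively. Analytic pseudo-differential operator: formally $(\operatorname{Op}_{\mathfrak V}(a)F)(z)=\int_{\mathbf C^d}a(z,w)F(w)e^{(z,w)}\,d\mu(w)$, with $(z,w)=\sum_jz_j\overline{w_j}$ and $d\mu(w)=\pi^{-d}e^{-|w|^2}d\lambda(w)$. In general $\operatorname{Op}_{\mathfrak V}(a)$ is the operator with kernel $K=e^{(z,w)}a(z,w)$ with respect to $d\mu$, where this multiplication is the (continuously extended) map on formal series with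 coefficients $c_K(\alpha,\beta)=\sum_{\gamma\le\alpha,\beta}c_a(\alpha-\gamma,\beta-\gamma)\left(\binom{\alpha}{\gamma}\binom{\beta}{\gamma}\right)^{1/2}$, and the operator with kernel $K$ maps $F=\sum c(F,\beta)e_\beta\in\mathcal A_0(\mathbf C^d)$ to $\sum_\alpha\big(\sum_\beta c_K(\alpha,\beta)c(F,\beta)\big)e_\alpha\in\mathcal A_0'(\mathbf C^d)$. *)

theory Defs
  imports "HOL-Analysis.Analysis"
begin

section \<open>The extended index set\<close>

text \<open>
  \<open>Num x\<close> is the real number \<open>x\<close> and \<open>Flat \<sigma>\<close> is the formal symbol \<open>\<flat>\<^sub>\<sigma>\<close>.  Only the
  elements of \<open>R_flat\<close> and \<open>R_flat0\<close> below are meaningful; on the other values the order is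
  given by the same formulas.
\<close>

datatype flat_real = Num real | Flat real

instantiation flat_real :: linorder
begin

fun less_flat_real :: "flat_real \<Rightarrow> flat_real \<Rightarrow> bool" where
  "less_flat_real (Num x) (Num y) \<longleftrightarrow> x < y"
| "less_flat_real (Num x) (Flat \<tau>) \<longleftrightarrow> x < 1/2"
| "less_flat_real (Flat \<sigma>) (Num y) \<longleftrightarrow> 1/2 \<le> y"
| "less_flat_real (Flat \<sigma>) (Flat \<tau>) \<longleftrightarrow> \<sigma> < \<tau>"

definition less_eq_flat_real :: "flat_real \<Rightarrow> flat_real \<Rightarrow> bool" where
  "less_eq_flat_real s t \<longleftrightarrow> s < t \<or> s = t"

instance
proof
  fix x y z :: flat_real
  show "(x < y) = (x \<le> y \<and> \<not> y \<le> x)"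
    by (cases x; cases y) (auto simp: less_eq_flat_real_def)
  show "x \<le> x"
    by (simp add: less_eq_flat_real_def)
  show "x \<le> y \<Longrightarrow> y \<le> z \<Longrightarrow> x \<le> z"
    by (cases x; cases y; cases z) (auto simp: less_eq_flat_real_def)
  show "x \<le> y \<Longrightarrow> y \<le> x \<Longrightarrow> x = y"
    by (cases x; cases y) (auto simp: less_eq_flat_real_def)
  show "x \<le> y \<or> y \<le> x"
    by (cases x; cases y) (auto simp: less_eq_flat_real_def)
qed

end

definition R_flat :: "flat_real set" where
  "R_flat = Num ` {0<..} \<union> Flat ` {0<..}"

definition R_flat0 :: "flat_real set" where
  "R_flat0 = insert (Num 0) R_flat"


section \<open>Multi-indices and weights\<close>

text \<open>Elements of \<open>\<nat>\<^sup>n\<close> are functions \<open>'n \<Rightarrow> nat\<close> on a finite index type with \<open>CARD('n) = n\<close>.\<close>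

definition mlen :: "('n::finite \<Rightarrow> nat) \<Rightarrow> nat" where
  "mlen \<alpha> = (\<Sum>j\<in>UNIV. \<alpha> j)"

definition mfact :: "('n::finite \<Rightarrow> nat) \<Rightarrow> real" where
  "mfact \<alpha> = (\<Prod>j\<in>UNIV. fact (\<alpha> j))"

definition mbinom :: "('n::finite \<Rightarrow> nat) \<Rightarrow> ('n \<Rightarrow> nat) \<Rightarrow> real" where
  "mbinom \<alpha> \<gamma> = (\<Prod>j\<in>UNIV. real (\<alpha> j choose \<gamma> j))"

fun weight :: "real \<Rightarrow> flat_real \<Rightarrow> ('n::finite \<Rightarrow> nat) \<Rightarrow> real" where
  "weight r (Num s) \<alpha> = exp (r * real (mlen \<alpha>) powr (1 / (2 * s)))"
| "weight r (Flat \<sigma>) \<alpha> = r ^ mlen \<alpha> * mfact \<alpha> powr (1 / (2 * \<sigma>))"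


section \<open>Topologies on spaces of families of complex numbers\<close>

definition seminorm_topology ::
  "('i \<Rightarrow> complex) set \<Rightarrow> (('i \<Rightarrow> complex) \<Rightarrow> real) set \<Rightarrow> ('i \<Rightarrow> complex) topology" where
  "seminorm_topology V Q =
     topology_generated_by {{y \<in> V. q (y - x) < e} | q x e. q \<in> Q \<and> x \<in> V \<and> 0 < e}"

text \<open>The initial topology on the intersection with respect to all the inclusions.\<close>

definition proj_limit :: "('i \<Rightarrow> complex) topology set \<Rightarrow> ('i \<Rightarrow> complex) topology" where
  "proj_limit \<X> =
     topology_generated_by {(\<Inter>X\<in>\<X>. topspace X) \<inter> U | X U. X \<in> \<X> \<and> openin X U}"

definition abs_convex :: "('i \<Rightarrow> complex) set \<Rightarrow> bool" where
  "abs_convex W \<longleftrightarrow>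
     (\<forall>x\<in>W. \<forall>y\<in>W. \<forall>a b. norm a + norm b \<le> 1 \<longrightarrow> (\<lambda>i. a * x i + b * y i) \<in> W)"

text \<open>
  The locally convex inductive limit of an increasing family: the finest locally convex
  topology on the union for which all inclusions are continuous.  A base of neighbourhoods
  of 0 is given by the absolutely convex sets that meet every step in a neighbourhood of 0.
\<close>

definition ind_limit_nhd0 :: "('i \<Rightarrow> complex) topology set \<Rightarrow> ('i \<Rightarrow> complex) set \<Rightarrow> bool" where
  "ind_limit_nhd0 \<X> W \<longleftrightarrow> W \<subseteq> (\<Union>X\<in>\<X>. topspace X) \<and> abs_convex W \<and>
     (\<forall>X\<in>\<X>. \<exists>N. openin X N \<and> (\<lambda>_. 0) \<in> N \<and> N \<subseteq> W)"

definition ind_limit_open :: "('i \<Rightarrow> complex) topology set \<Rightarrow> ('i \<Rightarrow> complex) set \<Rightarrow> bool" where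
  "ind_limit_open \<X> U \<longleftrightarrow> U \<subseteq> (\<Union>X\<in>\<X>. topspace X) \<and>
     (\<forall>x\<in>U. \<exists>W. ind_limit_nhd0 \<X> W \<and> (\<forall>w\<in>W. (\<lambda>i. x i + w i) \<in> U))"

definition ind_limit :: "('i \<Rightarrow> complex) topology set \<Rightarrow> ('i \<Rightarrow> complex) topology" where
  "ind_limit \<X> = topology (ind_limit_open \<X>)"

lemma ind_limit_nhd0_Int:
  assumes "ind_limit_nhd0 \<X> W" "ind_limit_nhd0 \<X> W'"
  shows "ind_limit_nhd0 \<X> (W \<inter> W')"
  unfolding ind_limit_nhd0_def
proof (intro conjI ballI)
  show "W \<inter> W' \<subseteq> (\<Union>X\<in>\<X>. topspace X)"
    using assms by (auto simp: ind_limit_nhd0_def)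
  show "abs_convex (W \<inter> W')"
    using assms unfolding ind_limit_nhd0_def abs_convex_def by simp
  fix X assume "X \<in> \<X>"
  then obtain N N' where "openin X N" "(\<lambda>_. 0) \<in> N" "N \<subseteq> W"
    "openin X N'" "(\<lambda>_. 0) \<in> N'" "N' \<subseteq> W'"
    using assms unfolding ind_limit_nhd0_def by meson
  then show "\<exists>N. openin X N \<and> (\<lambda>_. 0) \<in> N \<and> N \<subseteq> W \<inter> W'"
    by (intro exI[of _ "N \<inter> N'"]) auto
qed

lemma openin_ind_limit: "openin (ind_limit \<X>) U \<longleftrightarrow> ind_limit_open \<X> U"
proof -
  have "istopology (ind_limit_open \<X>)"
    unfolding istopology_def
  proof (intro conjI allI impI)
    fix S T assume S: "ind_limit_open \<X> S" and T: "ind_limit_open \<X> T"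
    show "ind_limit_open \<X> (S \<inter> T)"
      unfolding ind_limit_open_def
    proof (intro conjI ballI)
      show "S \<inter> T \<subseteq> (\<Union>X\<in>\<X>. topspace X)"
        using S by (auto simp: ind_limit_open_def)
      fix x assume x: "x \<in> S \<inter> T"
      obtain W where W: "ind_limit_nhd0 \<X> W" "\<forall>w\<in>W. (\<lambda>i. x i + w i) \<in> S"
        using S x unfolding ind_limit_open_def by blast
      obtain W' where W': "ind_limit_nhd0 \<X> W'" "\<forall>w\<in>W'. (\<lambda>i. x i + w i) \<in> T"
        using T x unfolding ind_limit_open_def by blast
      show "\<exists>W. ind_limit_nhd0 \<X> W \<and> (\<forall>w\<in>W. (\<lambda>i. x i + w i) \<in> S \<inter> T)"
        using W W' ind_limit_nhd0_Int by (intro exI[of _ "W \<inter> W'"]) auto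
    qed
  next
    fix \<K> assume K: "\<forall>K\<in>\<K>. ind_limit_open \<X> K"
    show "ind_limit_open \<X> (\<Union>\<K>)"
      unfolding ind_limit_open_def
    proof (intro conjI ballI)
      show "\<Union>\<K> \<subseteq> (\<Union>X\<in>\<X>. topspace X)"
        using K unfolding ind_limit_open_def by blast
      fix x assume "x \<in> \<Union>\<K>"
      then obtain S where S: "S \<in> \<K>" "x \<in> S" by blast
      then obtain W where "ind_limit_nhd0 \<X> W" "\<forall>w\<in>W. (\<lambda>i. x i + w i) \<in> S"
        using K unfolding ind_limit_open_def by blast
      then show "\<exists>W. ind_limit_nhd0 \<X> W \<and> (\<forall>w\<in>W. (\<lambda>i. x i + w i) \<in> \<Union>\<K>)"
        using S by blast
    qed
  qed
  then show ?thesis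
    by (simp add: ind_limit_def topology_inverse')
qed


lemma topspace_seminorm_topology:
  assumes "Q \<noteq> {}" "\<And>q. q \<in> Q \<Longrightarrow> q (\<lambda>_. 0) = 0"
  shows "topspace (seminorm_topology V Q) = V"
proof -
  obtain q where q: "q \<in> Q" using assms(1) by blast
  have "x \<in> topspace (seminorm_topology V Q)" if "x \<in> V" for x
  proof -
    have "x - x = (\<lambda>_. 0)" by auto
    then have "x \<in> {y \<in> V. q (y - x) < 1}" using that assms(2)[OF q] by simp
    then show ?thesis
      unfolding seminorm_topology_def topology_generated_by_topspace using q that zero_less_one
      by blast
  qed
  then show ?thesis
    by (auto simp: seminorm_topology_def topology_generated_by_topspace)
qed

lemma topspace_proj_limit:
  assumes "\<X> \<noteq> {}"
  shows "topspace (proj_limit \<X>) = (\<Inter>X\<in>\<X>. topspace X)"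
proof -
  obtain X where X: "X \<in> \<X>" using assms by blast
  show ?thesis
  proof
    show "topspace (proj_limit \<X>) \<subseteq> (\<Inter>X\<in>\<X>. topspace X)"
      by (auto simp: proj_limit_def topology_generated_by_topspace)
    show "(\<Inter>X\<in>\<X>. topspace X) \<subseteq> topspace (proj_limit \<X>)"
      unfolding proj_limit_def topology_generated_by_topspace
    proof
      fix x assume x: "x \<in> (\<Inter>X\<in>\<X>. topspace X)"
      then have "x \<in> (\<Inter>X\<in>\<X>. topspace X) \<inter> topspace X" using X by blast
      then show "x \<in> \<Union>{(\<Inter>X\<in>\<X>. topspace X) \<inter> U | X U. X \<in> \<X> \<and> openin X U}"
        using X openin_topspace by blast
    qed
  qed
qed

definition lin_closed :: "('i \<Rightarrow> complex) set \<Rightarrow> bool" where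
  "lin_closed V \<longleftrightarrow> (\<lambda>_. 0) \<in> V \<and>
     (\<forall>x\<in>V. \<forall>y\<in>V. \<forall>a b. (\<lambda>i. a * x i + b * y i) \<in> V)"

lemma topspace_ind_limit:
  assumes lin: "\<And>X. X \<in> \<X> \<Longrightarrow> lin_closed (topspace X)"
    and dir: "\<And>X Y. X \<in> \<X> \<Longrightarrow> Y \<in> \<X> \<Longrightarrow> topspace X \<subseteq> topspace Y \<or> topspace Y \<subseteq> topspace X"
  shows "topspace (ind_limit \<X>) = (\<Union>X\<in>\<X>. topspace X)"
proof -
  let ?V = "\<Union>X\<in>\<X>. topspace X"
  have comb: "(\<lambda>i. a * x i + b * y i) \<in> ?V" if xy: "x \<in> ?V" "y \<in> ?V" for x y a b
  proof -
    obtain X Y where X: "X \<in> \<X>" "x \<in> topspace X" and Y: "Y \<in> \<X>" "y \<in> topspace Y"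
      using xy by blast
    then obtain Z where Z: "Z \<in> \<X>" "x \<in> topspace Z" "y \<in> topspace Z"
      using dir[OF X(1) Y(1)] by blast
    then show ?thesis using lin[OF Z(1)] unfolding lin_closed_def by blast
  qed
  have "ind_limit_nhd0 \<X> ?V"
    unfolding ind_limit_nhd0_def abs_convex_def
  proof (intro conjI ballI allI impI)
    show "\<exists>N. openin X N \<and> (\<lambda>_. 0) \<in> N \<and> N \<subseteq> ?V" if "X \<in> \<X>" for X
      using that lin[OF that] unfolding lin_closed_def by (intro exI[of _ "topspace X"]) auto
  qed (use comb in auto)
  moreover have "(\<lambda>i. x i + w i) \<in> ?V" if "x \<in> ?V" "w \<in> ?V" for x w
    using comb[OF that, of 1 1] by simp
  ultimately have "openin (ind_limit \<X>) ?V"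
    unfolding openin_ind_limit ind_limit_open_def by blast
  moreover have "topspace (ind_limit \<X>) \<subseteq> ?V"
    using openin_topspace[of "ind_limit \<X>"] unfolding openin_ind_limit ind_limit_open_def by blast
  ultimately show ?thesis
    by (metis openin_subset subset_antisym)
qed


section \<open>Sequence spaces\<close>

text \<open>The exponent \<open>p\<close> ranges over \<open>[1, \<infinity>]\<close>, taken in \<open>ennreal\<close>.\<close>

definition in_lp :: "ennreal \<Rightarrow> ('i \<Rightarrow> complex) \<Rightarrow> bool" where
  "in_lp p c \<longleftrightarrow>
     (if p = \<infinity> then bounded (range c)
      else (\<lambda>i. norm (c i) powr enn2real p) summable_on UNIV)"

definition lp_norm :: "ennreal \<Rightarrow> ('i \<Rightarrow> complex) \<Rightarrow> real" where
  "lp_norm p c =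
     (if p = \<infinity> then (SUP i. norm (c i))
      else (\<Sum>\<^sub>\<infinity>i. norm (c i) powr enn2real p) powr (1 / enn2real p))"

definition weighted_lp :: "ennreal \<Rightarrow> ('i \<Rightarrow> real) \<Rightarrow> ('i \<Rightarrow> complex) topology" where
  "weighted_lp p \<theta> = seminorm_topology
     {c. in_lp p (\<lambda>i. c i * of_real (\<theta> i))} {\<lambda>c. lp_norm p (\<lambda>i. c i * of_real (\<theta> i))}"

text \<open>
  Each of the following spaces is represented by its topology; its underlying set is the
  \<open>topspace\<close>.  \<open>ell0 p s\<close>, \<open>ell p s\<close>, \<open>ell_dual p s\<close>, \<open>ell0_dual p s\<close> are
  \<open>\<ell>\<^bsub>0,s\<^esub>\<close>, \<open>\<ell>\<^sub>s\<close>, \<open>\<ell>\<^sub>s'\<close>, \<open>\<ell>\<^bsub>0,s\<^esub>'\<close>; the index \<open>s = 0\<close> is admitted only for \<open>ell\<close> and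
  \<open>ell_dual\<close>, where it has its own definition.
\<close>

definition ell0 :: "ennreal \<Rightarrow> flat_real \<Rightarrow> (('n::finite \<Rightarrow> nat) \<Rightarrow> complex) topology" where
  "ell0 p s = proj_limit {weighted_lp p (weight r s) | r. 0 < r}"

definition ell :: "ennreal \<Rightarrow> flat_real \<Rightarrow> (('n::finite \<Rightarrow> nat) \<Rightarrow> complex) topology" where
  "ell p s =
     (if s = Num 0
      then ind_limit {seminorm_topology {c. \<forall>\<alpha>. mlen \<alpha> > N \<longrightarrow> c \<alpha> = 0} {lp_norm p} | N. True}
      else ind_limit {weighted_lp p (weight r s) | r. 0 < r})"

definition ell_dual :: "ennreal \<Rightarrow> flat_real \<Rightarrow> (('n::finite \<Rightarrow> nat) \<Rightarrow> complex) topology" where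
  "ell_dual p s =
     (if s = Num 0
      then seminorm_topology UNIV
             {\<lambda>c. lp_norm p (\<lambda>\<alpha>. if mlen \<alpha> \<le> N then c \<alpha> else 0) | N. True}
      else proj_limit {weighted_lp p (\<lambda>\<alpha>. 1 / weight r s \<alpha>) | r. 0 < r})"

definition ell0_dual :: "ennreal \<Rightarrow> flat_real \<Rightarrow> (('n::finite \<Rightarrow> nat) \<Rightarrow> complex) topology" where
  "ell0_dual p s = ind_limit {weighted_lp p (\<lambda>\<alpha>. 1 / weight r s \<alpha>) | r. 0 < r}"


text \<open>The underlying sets are as expected.\<close>

lemma lp_norm_zero [simp]: "lp_norm p (\<lambda>_. 0) = 0"
  by (simp add: lp_norm_def)

lemma topspace_weighted_lp:
  "topspace (weighted_lp p \<theta>) = {c. in_lp p (\<lambda>i. c i * of_real (\<theta> i))}"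
  unfolding weighted_lp_def by (rule topspace_seminorm_topology) auto

lemma in_lp_comparison:
  assumes c: "in_lp p c" and d: "in_lp p d" and le: "\<And>i. norm (e i) \<le> A * norm (c i) + B * norm (d i)"
    and AB: "A \<ge> 0" "B \<ge> 0"
  shows "in_lp p e"
proof (cases "p = \<infinity>")
  case True
  then obtain M N where M: "\<And>i. norm (c i) \<le> M" and N: "\<And>i. norm (d i) \<le> N"
    using c d unfolding in_lp_def bounded_iff by auto
  have "norm (e i) \<le> A * M + B * N" for i
    using le[of i] mult_left_mono[OF M[of i] AB(1)] mult_left_mono[OF N[of i] AB(2)] by linarith
  then show ?thesis
    using True by (auto simp: in_lp_def bounded_iff intro: exI[of _ "A * M + B * N"])
next
  case False
  define q where "q = enn2real p"
  have q: "q \<ge> 0" by (simp add: q_def)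
  have s: "(\<lambda>i. norm (c i) powr q) summable_on UNIV" "(\<lambda>i. norm (d i) powr q) summable_on UNIV"
    using c d False by (auto simp: in_lp_def q_def)
  have "(\<lambda>i. (2 * A) powr q * norm (c i) powr q + (2 * B) powr q * norm (d i) powr q) summable_on UNIV"
    by (intro summable_on_add summable_on_cmult_right s)
  then have "(\<lambda>i. norm (e i) powr q) summable_on UNIV"
  proof (rule summable_on_comparison_test)
    fix i
    have "norm (e i) \<le> max (2 * A * norm (c i)) (2 * B * norm (d i))"
      using le[of i] by linarith
    then have "norm (e i) powr q \<le> max (2 * A * norm (c i)) (2 * B * norm (d i)) powr q"
      by (intro powr_mono2 q) simp_all
    also have "\<dots> \<le> (2 * A * norm (c i)) powr q + (2 * B * norm (d i)) powr q"
      unfolding max_def by (simp split: if_split)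
    also have "\<dots> = (2 * A) powr q * norm (c i) powr q + (2 * B) powr q * norm (d i) powr q"
      using AB by (subst (1 2) powr_mult) simp_all
    finally show "norm (e i) powr q \<le> \<dots>" .
  qed auto
  then show ?thesis using False by (simp add: in_lp_def q_def)
qed

lemma lin_closed_weighted_lp: "lin_closed (topspace (weighted_lp p \<theta>))"
  unfolding lin_closed_def topspace_weighted_lp
proof (intro conjI ballI allI)
  show "(\<lambda>_. 0) \<in> {c. in_lp p (\<lambda>i. c i * of_real (\<theta> i))}"
    by (simp add: in_lp_def)
  fix x y :: "'a \<Rightarrow> complex" and a b :: complex
  assume "x \<in> {c. in_lp p (\<lambda>i. c i * of_real (\<theta> i))}" "y \<in> {c. in_lp p (\<lambda>i. c i * of_real (\<theta> i))}"
  then have "in_lp p (\<lambda>i. x i * of_real (\<theta> i))" "in_lp p (\<lambda>i. y i * of_real (\<theta> i))"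
    by simp_all
  then have "in_lp p (\<lambda>i. (a * x i + b * y i) * of_real (\<theta> i))"
  proof (rule in_lp_comparison[where A = "norm a" and B = "norm b"
          and c = "\<lambda>i. x i * of_real (\<theta> i)" and d = "\<lambda>i. y i * of_real (\<theta> i)"])
    fix i
    have "norm ((a * x i + b * y i) * of_real (\<theta> i)) =
        norm (a * (x i * of_real (\<theta> i)) + b * (y i * of_real (\<theta> i)))"
      by (simp add: algebra_simps)
    also have "\<dots> \<le> norm (a * (x i * of_real (\<theta> i))) + norm (b * (y i * of_real (\<theta> i)))"
      by (rule norm_triangle_ineq)
    finally show "norm ((a * x i + b * y i) * of_real (\<theta> i)) \<le>
        norm a * norm (x i * of_real (\<theta> i)) + norm b * norm (y i * of_real (\<theta> i))"
      by (simp only: norm_mult)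
  qed simp_all
  then show "(\<lambda>i. a * x i + b * y i) \<in> {c. in_lp p (\<lambda>i. c i * of_real (\<theta> i))}"
    by simp
qed

lemma weighted_lp_mono:
  assumes "\<And>i. \<bar>\<theta> i\<bar> \<le> \<bar>\<theta>' i\<bar>"
  shows "topspace (weighted_lp p \<theta>') \<subseteq> topspace (weighted_lp p \<theta>)"
proof
  fix c assume "c \<in> topspace (weighted_lp p \<theta>')"
  then have "in_lp p (\<lambda>i. c i * of_real (\<theta>' i))" by (simp add: topspace_weighted_lp)
  from this this have "in_lp p (\<lambda>i. c i * of_real (\<theta> i))"
    by (rule in_lp_comparison[where A = 1 and B = 0 and c = "\<lambda>i. c i * of_real (\<theta>' i)"
          and d = "\<lambda>i. c i * of_real (\<theta>' i)"]) (simp_all add: norm_mult mult_left_mono assms)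
  then show "c \<in> topspace (weighted_lp p \<theta>)" by (simp add: topspace_weighted_lp)
qed

lemma mfact_pos: "mfact \<alpha> > 0"
  unfolding mfact_def by (rule prod_pos) simp

lemma weight_pos: "r > 0 \<Longrightarrow> weight r s \<alpha> > 0"
  by (cases s) (simp_all add: less_imp_neq[OF mfact_pos, symmetric])

lemma abs_weight: "r > 0 \<Longrightarrow> \<bar>weight r s \<alpha>\<bar> = weight r s \<alpha>"
  by (rule abs_of_pos) (rule weight_pos)

lemma weight_mono: "0 < r \<Longrightarrow> r \<le> r' \<Longrightarrow> weight r s \<alpha> \<le> weight r' s \<alpha>"
  by (cases s) (auto intro!: mult_right_mono power_mono)

lemma setcompr_pos_eq_image: "{f r | r :: real. 0 < r} = f ` {0<..}"
  by auto

lemma topspace_ell0: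
  "topspace (ell0 p s) = {c. \<forall>r>0. in_lp p (\<lambda>\<alpha>. c \<alpha> * of_real (weight r s \<alpha>))}"
  by (auto simp: ell0_def setcompr_pos_eq_image topspace_proj_limit topspace_weighted_lp)

lemma topspace_ind_limit_weighted_lp:
  assumes "\<And>r r'. 0 < r \<Longrightarrow> r \<le> r' \<Longrightarrow>
      topspace (weighted_lp p (\<theta> r)) \<subseteq> topspace (weighted_lp p (\<theta> r')) \<or>
      topspace (weighted_lp p (\<theta> r')) \<subseteq> topspace (weighted_lp p (\<theta> r))"
  shows "topspace (ind_limit {weighted_lp p (\<theta> r) | r :: real. 0 < r}) =
      {c. \<exists>r>0. in_lp p (\<lambda>\<alpha>. c \<alpha> * of_real (\<theta> r \<alpha>))}"
proof -
  have "topspace (ind_limit ((\<lambda>r. weighted_lp p (\<theta> r)) ` {0<..})) =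
      (\<Union>X\<in>(\<lambda>r. weighted_lp p (\<theta> r)) ` {0<..}. topspace X)"
  proof (rule topspace_ind_limit)
    fix X Y assume "X \<in> (\<lambda>r. weighted_lp p (\<theta> r)) ` {0<..}" "Y \<in> (\<lambda>r. weighted_lp p (\<theta> r)) ` {0<..}"
    then obtain r r' where r: "0 < r" "0 < r'"
      and XY: "X = weighted_lp p (\<theta> r)" "Y = weighted_lp p (\<theta> r')" by auto
    show "topspace X \<subseteq> topspace Y \<or> topspace Y \<subseteq> topspace X"
      using assms[of r r'] assms[of r' r] r unfolding XY by linarith
  qed (auto simp: lin_closed_weighted_lp)
  then show ?thesis
    by (auto simp: setcompr_pos_eq_image topspace_weighted_lp)
qed

lemma topspace_ell:
  assumes "s \<noteq> Num 0"
  shows "topspace (ell p s) = {c. \<exists>r>0. in_lp p (\<lambda>\<alpha>. c \<alpha> * of_real (weight r s \<alpha>))}"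
  unfolding ell_def using assms
  by (simp, intro topspace_ind_limit_weighted_lp disjI2 weighted_lp_mono)
     (simp add: abs_weight weight_mono)

lemma topspace_ell_zero:
  "topspace (ell p (Num 0)) = {c :: ('n::finite \<Rightarrow> nat) \<Rightarrow> complex. finite {\<alpha>. c \<alpha> \<noteq> 0}}"
proof -
  let ?V = "\<lambda>N. {c :: ('n \<Rightarrow> nat) \<Rightarrow> complex. \<forall>\<alpha>. mlen \<alpha> > N \<longrightarrow> c \<alpha> = 0}"
  have top: "topspace (seminorm_topology (?V N) {lp_norm p}) = ?V N" for N
    by (rule topspace_seminorm_topology) auto
  have "topspace (ind_limit {seminorm_topology (?V N) {lp_norm p} | N. True}) =
      (\<Union>X\<in>{seminorm_topology (?V N) {lp_norm p} | N. True}. topspace X)"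
  proof (rule topspace_ind_limit)
    fix X Y assume "X \<in> {seminorm_topology (?V N) {lp_norm p} | N. True}"
      and "Y \<in> {seminorm_topology (?V N) {lp_norm p} | N. True}"
    then obtain M N where XY: "topspace X = ?V M" "topspace Y = ?V N" using top by blast
    have "?V M \<subseteq> ?V N" if "M \<le> N" for M N using that by auto
    then show "topspace X \<subseteq> topspace Y \<or> topspace Y \<subseteq> topspace X"
      unfolding XY by (meson linear)
  qed (auto simp: top lin_closed_def)
  also have "\<dots> = (\<Union>N. ?V N)"
    using top by auto
  also have "\<dots> = {c. finite {\<alpha>. c \<alpha> \<noteq> 0}}"
  proof (intro equalityI subsetI)
    fix c assume "c \<in> (\<Union>N. ?V N)"
    then obtain N where N: "\<And>\<alpha>. mlen \<alpha> > N \<Longrightarrow> c \<alpha> = 0" by blast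
    have "\<alpha> \<in> Pi\<^sub>E UNIV (\<lambda>_. {..N})" if "c \<alpha> \<noteq> 0" for \<alpha>
    proof -
      have "mlen \<alpha> \<le> N" using N that by (meson not_le)
      moreover have "\<alpha> j \<le> mlen \<alpha>" for j
        unfolding mlen_def by (rule member_le_sum) auto
      ultimately show ?thesis by (auto intro: order_trans)
    qed
    then have "{\<alpha>. c \<alpha> \<noteq> 0} \<subseteq> Pi\<^sub>E UNIV (\<lambda>_. {..N})" by blast
    moreover have "finite (Pi\<^sub>E (UNIV :: 'n set) (\<lambda>_. {..N}))" by (rule finite_PiE) auto
    ultimately show "c \<in> {c. finite {\<alpha>. c \<alpha> \<noteq> 0}}" by (simp add: finite_subset)
  next
    fix c :: "('n \<Rightarrow> nat) \<Rightarrow> complex" assume "c \<in> {c. finite {\<alpha>. c \<alpha> \<noteq> 0}}"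
    then have fin: "finite {\<alpha>. c \<alpha> \<noteq> 0}" by simp
    have "mlen \<alpha> \<le> (\<Sum>\<beta> | c \<beta> \<noteq> 0. mlen \<beta>)" if "c \<alpha> \<noteq> 0" for \<alpha>
      by (rule member_le_sum) (use fin that in auto)
    then show "c \<in> (\<Union>N. ?V N)" by (auto simp: not_le[symmetric])
  qed
  finally show ?thesis by (simp add: ell_def)
qed

lemma topspace_ell_dual:
  assumes "s \<noteq> Num 0"
  shows "topspace (ell_dual p s) = {c. \<forall>r>0. in_lp p (\<lambda>\<alpha>. c \<alpha> * of_real (1 / weight r s \<alpha>))}"
  using assms
  by (auto simp: ell_dual_def setcompr_pos_eq_image topspace_proj_limit topspace_weighted_lp)

lemma topspace_ell_dual_zero: "topspace (ell_dual p (Num 0)) = UNIV"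
  unfolding ell_dual_def by (simp, rule topspace_seminorm_topology) auto

lemma topspace_ell0_dual:
  "topspace (ell0_dual p s) = {c. \<exists>r>0. in_lp p (\<lambda>\<alpha>. c \<alpha> * of_real (1 / weight r s \<alpha>))}"
  unfolding ell0_dual_def
  by (intro topspace_ind_limit_weighted_lp disjI1 weighted_lp_mono)
     (simp add: abs_weight weight_mono weight_pos frac_le)


section \<open>Spaces of formal power series\<close>

text \<open>
  A formal power series \<open>F\<close> in \<open>z \<in> \<complex>\<^sup>d\<close> is given by the coefficients \<open>F \<alpha>\<close> of the monomials
  \<open>z\<^sup>\<alpha>\<close>.  Since \<open>e\<^sub>\<alpha>(z) = z\<^sup>\<alpha> / sqrt \<alpha>!\<close>, its coefficients with respect to \<open>(e\<^sub>\<alpha>)\<close> are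
  \<open>c(F, \<alpha>) = sqrt \<alpha>! * F \<alpha>\<close>.
\<close>

type_synonym 'd power_series = "('d \<Rightarrow> nat) \<Rightarrow> complex"

definition coef :: "'d::finite power_series \<Rightarrow> ('d \<Rightarrow> nat) \<Rightarrow> complex" where
  "coef F \<alpha> = of_real (sqrt (mfact \<alpha>)) * F \<alpha>"

definition series_of_coef :: "(('d::finite \<Rightarrow> nat) \<Rightarrow> complex) \<Rightarrow> 'd power_series" where
  "series_of_coef c \<alpha> = c \<alpha> / of_real (sqrt (mfact \<alpha>))"

lemma
  fixes c :: "('d::finite \<Rightarrow> nat) \<Rightarrow> complex" and F :: "'d power_series"
  shows coef_series_of_coef [simp]: "coef (series_of_coef c) = c"
    and series_of_coef_coef [simp]: "series_of_coef (coef F) = F"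
proof -
  have "mfact \<alpha> \<noteq> 0" for \<alpha> :: "'d \<Rightarrow> nat"
    by (metis mfact_pos less_irrefl)
  then show "coef (series_of_coef c) = c" "series_of_coef (coef F) = F"
    by (auto simp: coef_def series_of_coef_def fun_eq_iff)
qed

definition A0_space :: "ennreal \<Rightarrow> flat_real \<Rightarrow> 'd::finite power_series topology" where
  "A0_space p s = pullback_topology UNIV coef (ell0 p s)"

definition A_space :: "ennreal \<Rightarrow> flat_real \<Rightarrow> 'd::finite power_series topology" where
  "A_space p s = pullback_topology UNIV coef (ell p s)"

definition A_dual :: "ennreal \<Rightarrow> flat_real \<Rightarrow> 'd::finite power_series topology" where
  "A_dual p s = pullback_topology UNIV coef (ell_dual p s)"

definition A0_dual :: "ennreal \<Rightarrow> flat_real \<Rightarrow> 'd::finite power_series topology" where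
  "A0_dual p s = pullback_topology UNIV coef (ell0_dual p s)"

text \<open>
  A formal series \<open>a(z,w)\<close> in \<open>z\<close> and the conjugate of \<open>w\<close>: \<open>a \<alpha> \<beta>\<close> is the coefficient of
  \<open>z\<^sup>\<alpha>\<close> times the \<open>\<beta>\<close>-th power of the conjugate of \<open>w\<close>.  The index set \<open>\<nat>\<^sup>2\<^sup>d\<close> is
  \<open>'d + 'd \<Rightarrow> nat\<close>, with \<open>(\<alpha>, \<beta>)\<close> given by the restrictions to the two summands.
\<close>

type_synonym 'd sesqui_series = "('d \<Rightarrow> nat) \<Rightarrow> ('d \<Rightarrow> nat) \<Rightarrow> complex"

definition coef2 :: "'d::finite sesqui_series \<Rightarrow> ('d \<Rightarrow> nat) \<Rightarrow> ('d \<Rightarrow> nat) \<Rightarrow> complex" where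
  "coef2 a \<alpha> \<beta> = of_real (sqrt (mfact \<alpha>) * sqrt (mfact \<beta>)) * a \<alpha> \<beta>"

definition coef2_seq :: "'d::finite sesqui_series \<Rightarrow> ('d + 'd \<Rightarrow> nat) \<Rightarrow> complex" where
  "coef2_seq a \<eta> = coef2 a (\<eta> \<circ> Inl) (\<eta> \<circ> Inr)"

definition A_tilde_dual :: "ennreal \<Rightarrow> flat_real \<Rightarrow> 'd::finite sesqui_series topology" where
  "A_tilde_dual p s = pullback_topology UNIV coef2_seq (ell_dual p s)"

definition A0_tilde_dual :: "ennreal \<Rightarrow> flat_real \<Rightarrow> 'd::finite sesqui_series topology" where
  "A0_tilde_dual p s = pullback_topology UNIV coef2_seq (ell0_dual p s)"


section \<open>Analytic pseudo-differential operators\<close>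

text \<open>
  The coefficients \<open>c\<^sub>K\<close> of the kernel \<open>K(z,w) = exp((z,w)) a(z,w)\<close> in terms of \<open>c\<^sub>a\<close>.
  Order and difference of multi-indices are pointwise.
\<close>

definition kernel_coef :: "'d::finite sesqui_series \<Rightarrow> ('d \<Rightarrow> nat) \<Rightarrow> ('d \<Rightarrow> nat) \<Rightarrow> complex" where
  "kernel_coef a \<alpha> \<beta> =
     (\<Sum>\<gamma> | \<gamma> \<le> \<alpha> \<and> \<gamma> \<le> \<beta>.
        coef2 a (\<alpha> - \<gamma>) (\<beta> - \<gamma>) * of_real (sqrt (mbinom \<alpha> \<gamma> * mbinom \<beta> \<gamma>)))"

text \<open>
  The operator on \<open>\<A>\<^sub>0\<close>, i.e. on series with finite support; the value on other series is
  irrelevant.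
\<close>

definition Op_V :: "'d::finite sesqui_series \<Rightarrow> 'd power_series \<Rightarrow> 'd power_series" where
  "Op_V a F = series_of_coef
     (\<lambda>\<alpha>. \<Sum>\<beta> | coef F \<beta> \<noteq> 0. kernel_coef a \<alpha> \<beta> * coef F \<beta>)"

definition linear_on_series ::
  "'d::finite power_series set \<Rightarrow> ('d power_series \<Rightarrow> 'd power_series) \<Rightarrow> bool" where
  "linear_on_series V T \<longleftrightarrow>
     (\<forall>F\<in>V. \<forall>G\<in>V. \<forall>a b. T (\<lambda>\<alpha>. a * F \<alpha> + b * G \<alpha>) = (\<lambda>\<alpha>. a * T F \<alpha> + b * T G \<alpha>))"

text \<open>
  Maps defined on the space \<open>X\<close> only are represented by functions that are \<open>undefined\<close>
  outside \<open>topspace X\<close> (\<open>extensional\<close>), so that \<open>\<exists>!\<close> has its usual meaning.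
\<close>

definition extends_uniquely ::
  "('d::finite power_series \<Rightarrow> 'd power_series) \<Rightarrow> 'd power_series set \<Rightarrow>
   'd power_series topology \<Rightarrow> 'd power_series topology \<Rightarrow> bool" where
  "extends_uniquely L D X Y \<longleftrightarrow> D \<subseteq> topspace X \<and>
     (\<exists>!T. T \<in> extensional (topspace X) \<and> linear_on_series (topspace X) T \<and>
           continuous_map X Y T \<and> (\<forall>F\<in>D. T F = L F))"

end

theory Submission imports Defs begin

text \<open>
  On coefficients the operator is the infinite matrix \<open>c\<^sub>K\<close>.  The sum defining \<open>c\<^sub>K(\<alpha>, \<beta>)\<close> costs at
  most a factor \<open>4\<close> to the power \<open>|\<alpha>| + |\<beta>|\<close>, which the weights absorb: for \<open>s < 1/2\<close> every
  \<open>r\<close> is reached from a small enough parameter, for \<open>s \<le> 1/2\<close> some larger \<open>r\<close> will do.  A spare factor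
  \<open>2\<close> to the power \<open>- |\<alpha>| - |\<beta>|\<close> makes the matrix bounded between the weighted \<open>\<ell>\<^sup>p\<close> spaces,
  whatever \<open>p\<close> is.  Uniqueness holds because truncations converge and the target is Hausdorff.
\<close>

section \<open>The seminorms of the weighted sequence spaces\<close>

text \<open>The two ranges of s reflect the order of quantifiers. For A_s and A_s' the symbol
  satisfies its bound with every parameter, but the matrix has to be bounded for every pair of
  parameters, so an exponent linear in |\<alpha>| must fit under an arbitrarily small multiple of
  |\<alpha>|^(1/(2s)); this requires 1/(2s) > 1. For A_{0,s} and A_{0,s}' one parameter is given and
  the other may be taken large, and 1/(2s) >= 1 is enough. At flat indices a geometric factor merely
  rescales r. The loss to absorb is 8 = 4 * 2 per unit of length, 2 being the spare decay. With that
  decay the operator uses only a sup bound on the weighted input and returns a multiple of a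
  geometric sequence, so conjugate exponents never enter. For p = \<infinity> truncations need not
  converge in the norm of the step that contains the sequence; changing the weight parameter gains a
  geometric factor, which makes them converge for every p. At s = 0 the finitely supported series
  already fill the source, and only continuity is at stake.\<close>

lemma powr_convex_nonneg:
  fixes x y u v q :: real
  assumes "1 \<le> q" "0 \<le> x" "0 \<le> y" "0 \<le> u" "0 \<le> v" "u + v = 1"
  shows "(u * x + v * y) powr q \<le> u * x powr q + v * y powr q"
proof -
  \<comment> \<open>Settles the boundary cases \<open>x = 0\<close> and \<open>y = 0\<close>;
    convexity is applied to positive arguments only.\<close>
  have scale: "(w * z) powr q \<le> w * z powr q" if "0 \<le> w" "w \<le> 1" "0 \<le> z" for w z
  proof -
    have "w powr q \<le> w"
      using powr_mono'[of 1 q w] that assms(1) by (cases "w = 0") auto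
    then show ?thesis using that by (simp add: powr_mult mult_right_mono)
  qed
  consider "x = 0" | "y = 0" | "0 < x" "0 < y" using assms by linarith
  then show ?thesis
  proof cases
    case 3
    then show ?thesis
      using convex_onD[OF powr_convex[OF assms(1)], of v x y] assms
      by (simp add: eq_diff_eq[symmetric])
  qed (use scale assms in auto)
qed

lemma enn2real_ge_1: "1 \<le> p \<Longrightarrow> p \<noteq> \<infinity> \<Longrightarrow> 1 \<le> enn2real p"
  using enn2real_mono[of 1 p] by (simp add: top.not_eq_extremum)

text \<open>For finite p the value is a power. For p = \<infinity> boundedness is essential, since
  the supremum of an unbounded set of reals carries no information.\<close>

lemma lp_norm_nonneg:
  assumes "in_lp p c"
  shows "0 \<le> lp_norm p c"
proof (cases "p = \<infinity>")
  case True
  then have "bdd_above (range (\<lambda>i. norm (c i)))"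
    using assms by (simp add: in_lp_def bdd_above_norm[symmetric] image_image)
  then have "norm (c undefined) \<le> (SUP i. norm (c i))" by (rule cSUP_upper[rotated]) simp
  then show ?thesis using True by (simp add: lp_norm_def order_trans[OF norm_ge_zero])
qed (simp add: lp_norm_def)

text \<open>The embedding of l^p into l^\<infinity>. Later coordinatewise estimates start from it
  and therefore treat every p alike.\<close>

lemma norm_le_lp_norm:
  assumes p: "1 \<le> p" and c: "in_lp p c"
  shows "norm (c i) \<le> lp_norm p c"
proof (cases "p = \<infinity>")
  case True
  then have "bdd_above (range (\<lambda>i. norm (c i)))"
    using c by (simp add: in_lp_def bdd_above_norm[symmetric] image_image)
  then have "norm (c i) \<le> (SUP i. norm (c i))" by (rule cSUP_upper[rotated]) simp
  then show ?thesis using True by (simp add: lp_norm_def)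
next
  case False
  define q where "q = enn2real p"
  have q: "1 \<le> q" using enn2real_ge_1 p False by (simp add: q_def)
  have "norm (c i) powr q \<le> (\<Sum>\<^sub>\<infinity>i. norm (c i) powr q)"
    using finite_sum_le_infsum[of "\<lambda>i. norm (c i) powr q" UNIV "{i}"] c False
    by (simp add: in_lp_def q_def)
  then have "(norm (c i) powr q) powr (1 / q) \<le> (\<Sum>\<^sub>\<infinity>i. norm (c i) powr q) powr (1 / q)"
    by (rule powr_mono2[rotated 2]) (use q in auto)
  then show ?thesis using q False by (simp add: powr_powr lp_norm_def q_def)
qed

lemma in_lp_dominated:
  assumes "in_lp p g" "\<And>i. norm (d i) \<le> B * norm (g i)" "0 \<le> B"
  shows "in_lp p d"
  by (rule in_lp_comparison[OF assms(1,1), where A = B and B = 0]) (use assms in auto)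

text \<open>Serves to compare a sequence known only by pointwise bounds with an explicit
  \<open>g\<close>, later a geometric sequence or the indicator of a finite block.\<close>

lemma lp_norm_dominated:
  assumes p: "1 \<le> p" and g: "in_lp p g" and le: "\<And>i. norm (d i) \<le> B * norm (g i)" and B: "0 \<le> B"
  shows "lp_norm p d \<le> B * lp_norm p g"
proof (cases "p = \<infinity>")
  case True
  have "norm (d i) \<le> B * lp_norm p g" for i
    using le[of i] mult_left_mono[OF norm_le_lp_norm[OF p g, of i] B] by linarith
  then show ?thesis using True by (simp add: lp_norm_def cSUP_least)
next
  case False
  define q where "q = enn2real p"
  have q: "1 \<le> q" using enn2real_ge_1 p False by (simp add: q_def)
  have sg: "(\<lambda>i. norm (g i) powr q) summable_on UNIV"
    using g False by (simp add: in_lp_def q_def)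
  have sd: "(\<lambda>i. norm (d i) powr q) summable_on UNIV"
    using in_lp_dominated[OF g le B] False by (simp add: in_lp_def q_def)
  have "(\<Sum>\<^sub>\<infinity>i. norm (d i) powr q) \<le> (\<Sum>\<^sub>\<infinity>i. B powr q * norm (g i) powr q)"
  proof (intro infsum_mono summable_on_cmult_right sg sd)
    fix i
    show "norm (d i) powr q \<le> B powr q * norm (g i) powr q"
      using powr_mono2[of q "norm (d i)" "B * norm (g i)"] le[of i] q B by (simp add: powr_mult)
  qed
  also have "\<dots> = B powr q * (\<Sum>\<^sub>\<infinity>i. norm (g i) powr q)"
    by (rule infsum_cmult_right')
  finally have "(\<Sum>\<^sub>\<infinity>i. norm (d i) powr q) powr (1/q) \<le> (B powr q * (\<Sum>\<^sub>\<infinity>i. norm (g i) powr q)) powr (1/q)"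
    by (rule powr_mono2[rotated 2]) (use q in \<open>auto intro: infsum_nonneg\<close>)
  also have "\<dots> = B * (\<Sum>\<^sub>\<infinity>i. norm (g i) powr q) powr (1/q)"
    using B q by (simp add: powr_mult powr_powr infsum_nonneg)
  finally show ?thesis using False by (simp add: lp_norm_def q_def)
qed

lemma in_lp_scale: "in_lp p c \<Longrightarrow> in_lp p (\<lambda>i. a * c i)"
  by (erule in_lp_dominated[where B = "norm a"]) (auto simp: norm_mult)

text \<open>Both inequalities are instances of domination, the second after multiplying back by the
  inverse of \<open>a\<close>.\<close>

lemma lp_norm_scale:
  assumes p: "1 \<le> p" and c: "in_lp p c"
  shows "lp_norm p (\<lambda>i. a * c i) = norm a * lp_norm p c"
proof (cases "a = 0")
  case False
  have "lp_norm p (\<lambda>i. a * c i) \<le> norm a * lp_norm p c"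
    by (rule lp_norm_dominated[OF p c]) (auto simp: norm_mult)
  moreover have "lp_norm p c \<le> inverse (norm a) * lp_norm p (\<lambda>i. a * c i)"
    by (rule lp_norm_dominated[OF p in_lp_scale[OF c]]) (use False in \<open>auto simp: norm_mult mult.assoc[symmetric]\<close>)
  ultimately show ?thesis using False by (simp add: field_simps)
qed simp

lemma in_lp_add: "in_lp p x \<Longrightarrow> in_lp p y \<Longrightarrow> in_lp p (\<lambda>i. x i + y i)"
  by (rule in_lp_comparison[of p x y _ 1 1]) (auto intro: norm_triangle_ineq)

text \<open>
  For finite \<open>p\<close> this is Minkowski's inequality, obtained from the convexity of \<open>t powr p\<close>
  applied to the convex combination of \<open>x / \<parallel>x\<parallel>\<close> and \<open>y / \<parallel>y\<parallel>\<close>.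
\<close>

lemma lp_norm_triangle:
  assumes p: "1 \<le> p" and x: "in_lp p x" and y: "in_lp p y"
  shows "lp_norm p (\<lambda>i. x i + y i) \<le> lp_norm p x + lp_norm p y"
\<comment> \<open>The convexity argument divides by both norms and needs a power sum, so vanishing
  norms and p = \<infinity> are split off.\<close>
proof (cases "lp_norm p x = 0 \<or> lp_norm p y = 0 \<or> p = \<infinity>")
  case True
  show ?thesis
  proof (cases "p = \<infinity>")
    case True
    have "norm (x i + y i) \<le> lp_norm p x + lp_norm p y" for i
      using norm_triangle_ineq[of "x i" "y i"] norm_le_lp_norm[OF p x, of i] norm_le_lp_norm[OF p y, of i]
      by linarith
    then show ?thesis using True by (simp add: lp_norm_def cSUP_least)
  next
    case False
    with True consider "lp_norm p x = 0" | "lp_norm p y = 0" by blast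
    then show ?thesis
    proof cases
      case 1
      then have "x i = 0" for i using norm_le_lp_norm[OF p x, of i] by simp
      then show ?thesis using 1 by simp
    next
      case 2
      then have "y i = 0" for i using norm_le_lp_norm[OF p y, of i] by simp
      then show ?thesis using 2 by simp
    qed
  qed
next
  case False
  define q where "q = enn2real p"
  define A where "A = lp_norm p x"
  define B where "B = lp_norm p y"
  have q: "1 \<le> q" using enn2real_ge_1 p False by (simp add: q_def)
  have AB: "0 < A" "0 < B"
    using False lp_norm_nonneg[OF x] lp_norm_nonneg[OF y] by (auto simp: A_def B_def)
  have sx: "(\<lambda>i. norm (x i) powr q) summable_on UNIV" and sy: "(\<lambda>i. norm (y i) powr q) summable_on UNIV"
    and sxy: "(\<lambda>i. norm (x i + y i) powr q) summable_on UNIV"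
    using x y in_lp_add[OF x y] False by (auto simp: in_lp_def q_def)
  have Aq: "(\<Sum>\<^sub>\<infinity>i. norm (x i) powr q) = A powr q"
    using False q by (simp add: A_def lp_norm_def q_def powr_powr infsum_nonneg)
  have Bq: "(\<Sum>\<^sub>\<infinity>i. norm (y i) powr q) = B powr q"
    using False q by (simp add: B_def lp_norm_def q_def powr_powr infsum_nonneg)
  \<comment> \<open>Weights proportional to the norms: \<open>A + B\<close> times the convex
    combination of \<open>norm (x i) / A\<close> and \<open>norm (y i) / B\<close> is then exactly
    \<open>norm (x i) + norm (y i)\<close>.\<close>
  define u where "u = A / (A + B)"
  define v where "v = B / (A + B)"
  have uv: "0 \<le> u" "0 \<le> v" "u + v = 1"
    using AB by (auto simp: u_def v_def add_divide_distrib[symmetric])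
  have bound: "norm (x i + y i) powr q \<le>
      (A + B) powr q * (u / A powr q * norm (x i) powr q + v / B powr q * norm (y i) powr q)" for i
  proof -
    have "norm (x i + y i) powr q \<le> ((A + B) * (u * (norm (x i) / A) + v * (norm (y i) / B))) powr q"
    proof (rule powr_mono2)
      have "(A + B) * (u * (norm (x i) / A) + v * (norm (y i) / B)) = norm (x i) + norm (y i)"
        using AB by (simp add: u_def v_def distrib_left)
      then show "norm (x i + y i) \<le> (A + B) * (u * (norm (x i) / A) + v * (norm (y i) / B))"
        by (simp add: norm_triangle_ineq)
    qed (use q in auto)
    also have "\<dots> = (A + B) powr q * (u * (norm (x i) / A) + v * (norm (y i) / B)) powr q"
      by (rule powr_mult)
    also have "\<dots> \<le> (A + B) powr q * (u * (norm (x i) / A) powr q + v * (norm (y i) / B) powr q)"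
      using AB uv q by (intro mult_left_mono powr_convex_nonneg) auto
    also have "\<dots> = (A + B) powr q * (u / A powr q * norm (x i) powr q + v / B powr q * norm (y i) powr q)"
      using AB by (simp add: powr_divide)
    finally show ?thesis .
  qed
  have "(\<Sum>\<^sub>\<infinity>i. norm (x i + y i) powr q) \<le>
      (\<Sum>\<^sub>\<infinity>i. (A + B) powr q * (u / A powr q * norm (x i) powr q + v / B powr q * norm (y i) powr q))"
    by (intro infsum_mono bound sxy summable_on_cmult_right summable_on_add sx sy)
  also have "\<dots> = (A + B) powr q *
      (u / A powr q * (\<Sum>\<^sub>\<infinity>i. norm (x i) powr q) + v / B powr q * (\<Sum>\<^sub>\<infinity>i. norm (y i) powr q))"
    by (simp only: infsum_cmult_right'
        infsum_add[OF summable_on_cmult_right[OF sx] summable_on_cmult_right[OF sy]])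
  also have "\<dots> = (A + B) powr q" using AB uv by (simp add: Aq Bq)
  finally have "(\<Sum>\<^sub>\<infinity>i. norm (x i + y i) powr q) powr (1/q) \<le> ((A + B) powr q) powr (1/q)"
    by (rule powr_mono2[rotated 2]) (use q in \<open>auto intro: infsum_nonneg\<close>)
  also have "\<dots> = A + B" using AB q by (simp add: powr_powr)
  finally show ?thesis using False by (simp add: lp_norm_def q_def A_def B_def)
qed

text \<open>Relative to a subspace \<open>V\<close> because off l^p the function
  \<open>lp_norm\<close> takes default values, for which the triangle inequality can fail.\<close>

definition seminorm_on :: "('i \<Rightarrow> complex) set \<Rightarrow> (('i \<Rightarrow> complex) \<Rightarrow> real) \<Rightarrow> bool" where
  "seminorm_on V q \<longleftrightarrow> lin_closed V \<and> (\<forall>x\<in>V. 0 \<le> q x) \<and>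
     (\<forall>x\<in>V. \<forall>a. q (\<lambda>i. a * x i) = norm a * q x) \<and>
     (\<forall>x\<in>V. \<forall>y\<in>V. q (\<lambda>i. x i + y i) \<le> q x + q y)"

lemma lin_closed_add: "lin_closed V \<Longrightarrow> x \<in> V \<Longrightarrow> y \<in> V \<Longrightarrow> (\<lambda>i. x i + y i) \<in> V"
  unfolding lin_closed_def by (drule conjunct2, drule bspec[of V _ x], simp, drule bspec[of V _ y],
      simp, drule spec[of _ 1], drule spec[of _ 1], simp)

lemma lin_closed_diff:
  assumes "lin_closed V" "x \<in> V" "y \<in> V"
  shows "x - y \<in> V"
proof -
  have "(\<lambda>i. 1 * x i + (- 1) * y i) \<in> V" using assms unfolding lin_closed_def by blast
  moreover have "(\<lambda>i. 1 * x i + (- 1) * y i) = x - y" by auto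
  ultimately show ?thesis by metis
qed

lemma lin_closed_scale:
  assumes "lin_closed V" "x \<in> V"
  shows "(\<lambda>i. a * x i) \<in> V"
proof -
  have "(\<lambda>i. a * x i + 0 * x i) \<in> V" using assms unfolding lin_closed_def by blast
  then show ?thesis by simp
qed

lemma seminorm_on_zero:
  assumes "seminorm_on V q" shows "q (\<lambda>_. 0) = 0"
proof -
  have "(\<lambda>_. 0) \<in> V" and "\<forall>x\<in>V. \<forall>a. q (\<lambda>i. a * x i) = norm a * q x"
    using assms by (simp_all add: seminorm_on_def lin_closed_def)
  from this(2)[rule_format, OF this(1), of 0] show ?thesis by simp
qed

lemma seminorm_on_lin_closed: "seminorm_on V q \<Longrightarrow> lin_closed V"
  by (simp add: seminorm_on_def)

lemma seminorm_on_triangle: "seminorm_on V q \<Longrightarrow> x \<in> V \<Longrightarrow> y \<in> V \<Longrightarrow> q (\<lambda>i. x i + y i) \<le> q x + q y"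
  by (simp add: seminorm_on_def)

lemma seminorm_on_subset: "seminorm_on V q \<Longrightarrow> lin_closed W \<Longrightarrow> W \<subseteq> V \<Longrightarrow> seminorm_on W q"
  unfolding seminorm_on_def by blast

lemma seminorm_on_weighted_lp:
  assumes "1 \<le> p"
  shows "seminorm_on {c. in_lp p (\<lambda>i. c i * of_real (\<theta> i))} (\<lambda>c. lp_norm p (\<lambda>i. c i * of_real (\<theta> i)))"
  unfolding seminorm_on_def
proof (intro conjI ballI allI)
  show "lin_closed {c. in_lp p (\<lambda>i. c i * of_real (\<theta> i))}"
    using lin_closed_weighted_lp[of p \<theta>] by (simp add: topspace_weighted_lp)
  fix x y assume "x \<in> {c. in_lp p (\<lambda>i. c i * of_real (\<theta> i))}" "y \<in> {c. in_lp p (\<lambda>i. c i * of_real (\<theta> i))}"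
  then show "lp_norm p (\<lambda>i. (x i + y i) * of_real (\<theta> i))
      \<le> lp_norm p (\<lambda>i. x i * of_real (\<theta> i)) + lp_norm p (\<lambda>i. y i * of_real (\<theta> i))"
    using lp_norm_triangle[OF assms, of "\<lambda>i. x i * of_real (\<theta> i)" "\<lambda>i. y i * of_real (\<theta> i)"]
    by (simp add: distrib_right)
next
  fix x a assume "x \<in> {c. in_lp p (\<lambda>i. c i * of_real (\<theta> i))}"
  then show "lp_norm p (\<lambda>i. a * x i * of_real (\<theta> i)) = norm a * lp_norm p (\<lambda>i. x i * of_real (\<theta> i))"
    using lp_norm_scale[OF assms, of "\<lambda>i. x i * of_real (\<theta> i)" a] by (simp add: mult.assoc)
qed (simp add: lp_norm_nonneg)


section \<open>Topologies given by seminorms, projective and inductive limits\<close>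

definition lin_on ::
  "('i \<Rightarrow> complex) set \<Rightarrow> (('i \<Rightarrow> complex) \<Rightarrow> ('j \<Rightarrow> complex)) \<Rightarrow> bool" where
  "lin_on V T \<longleftrightarrow>
     (\<forall>x\<in>V. \<forall>y\<in>V. \<forall>a b. T (\<lambda>i. a * x i + b * y i) = (\<lambda>j. a * T x j + b * T y j))"

lemma lin_on_subset: "lin_on V T \<Longrightarrow> W \<subseteq> V \<Longrightarrow> lin_on W T"
  unfolding lin_on_def by blast

lemma lin_on_ident: "lin_on V (\<lambda>x. x)"
  by (simp add: lin_on_def)

lemma lin_on_comb: "lin_on V T \<Longrightarrow> x \<in> V \<Longrightarrow> y \<in> V \<Longrightarrow>
    T (\<lambda>i. a * x i + b * y i) = (\<lambda>j. a * T x j + b * T y j)"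
  unfolding lin_on_def by blast

lemma lin_on_add: "lin_on V T \<Longrightarrow> x \<in> V \<Longrightarrow> y \<in> V \<Longrightarrow> T (\<lambda>i. x i + y i) = (\<lambda>j. T x j + T y j)"
  using lin_on_comb[of V T x y 1 1] by simp

lemma lin_on_diff:
  assumes "lin_on V T" "x \<in> V" "y \<in> V"
  shows "T (x - y) = T x - T y"
proof -
  have "x - y = (\<lambda>i. 1 * x i + (- 1) * y i)" by auto
  then have "T (x - y) = (\<lambda>j. 1 * T x j + (- 1) * T y j)"
    using lin_on_comb[OF assms, of 1 "- 1"] by metis
  then show ?thesis by (simp add: fun_eq_iff)
qed

lemma lin_on_zero:
  assumes "lin_on V T" "x \<in> V"
  shows "T (\<lambda>_. 0) = (\<lambda>_. 0)"
  using lin_on_comb[OF assms assms(2), of 0 0] by simp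

lemma openin_seminorm_ball:
  "q \<in> Q \<Longrightarrow> x \<in> V \<Longrightarrow> 0 < e \<Longrightarrow> openin (seminorm_topology V Q) {y \<in> V. q (y - x) < e}"
  unfolding seminorm_topology_def by (rule topology_generated_by_Basis) blast

lemma topspace_seminorm_topology_on:
  assumes "seminorm_on V q"
  shows "topspace (seminorm_topology V {q}) = V"
  by (rule topspace_seminorm_topology) (use seminorm_on_zero[OF assms] in auto)

text \<open>Preimages of the generating balls suffice, but about every centre \<open>z\<close> in
  \<open>V\<close>, since a centre need not be a value of \<open>T\<close>.\<close>

lemma continuous_map_into_seminorm_topology:
  assumes "Q \<noteq> {}" "\<And>q. q \<in> Q \<Longrightarrow> q (\<lambda>_. 0) = 0"
    and "\<And>x. x \<in> topspace X \<Longrightarrow> T x \<in> V"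
    and "\<And>q z e. q \<in> Q \<Longrightarrow> z \<in> V \<Longrightarrow> 0 < e \<Longrightarrow> openin X {x \<in> topspace X. q (T x - z) < e}"
  shows "continuous_map X (seminorm_topology V Q) T"
  unfolding seminorm_topology_def continuous_on_generated_topo_iff
proof (intro conjI allI impI)
  fix U assume "U \<in> {{y \<in> V. q (y - x) < e} |q x e. q \<in> Q \<and> x \<in> V \<and> 0 < e}"
  then obtain q z e where "q \<in> Q" "z \<in> V" "0 < e" and U: "U = {y \<in> V. q (y - z) < e}" by blast
  moreover have "T -` U \<inter> topspace X = {x \<in> topspace X. q (T x - z) < e}"
    using assms(3) unfolding U by auto
  ultimately show "openin X (T -` U \<inter> topspace X)" using assms(4) by simp
next
  have "\<Union> {{y \<in> V. q (y - x) < e} |q x e. q \<in> Q \<and> x \<in> V \<and> 0 < e} = V"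
    using topspace_seminorm_topology[of Q V] assms(1,2)
    by (simp add: seminorm_topology_def topology_generated_by_topspace)
  then show "T ` topspace X \<subseteq> \<Union> {{y \<in> V. q (y - x) < e} |q x e. q \<in> Q \<and> x \<in> V \<and> 0 < e}"
    using assms(3) by auto
qed

lemma continuous_map_seminorm_bounded:
  assumes q: "seminorm_on V q" and Q: "Q \<noteq> {}" "\<And>q'. q' \<in> Q \<Longrightarrow> seminorm_on V' q'"
    and T: "lin_on V T" "\<And>x. x \<in> V \<Longrightarrow> T x \<in> V'"
    and bd: "\<And>q'. q' \<in> Q \<Longrightarrow> \<exists>C. \<forall>x\<in>V. q' (T x) \<le> C * q x"
  shows "continuous_map (seminorm_topology V {q}) (seminorm_topology V' Q) T"
proof (rule continuous_map_into_seminorm_topology[OF Q(1)])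
  show "q' (\<lambda>_. 0) = 0" if "q' \<in> Q" for q' using Q(2)[OF that] by (rule seminorm_on_zero)
  note top = topspace_seminorm_topology_on[OF q]
  note V = seminorm_on_lin_closed[OF q]
  show "T x \<in> V'" if "x \<in> topspace (seminorm_topology V {q})" for x using that T(2) top by simp
  fix q' z and e :: real assume q': "q' \<in> Q" and z: "z \<in> V'" and e: "0 < e"
  note V' = seminorm_on_lin_closed[OF Q(2)[OF q']]
  obtain C where C: "\<And>x. x \<in> V \<Longrightarrow> q' (T x) \<le> C * q x" using bd[OF q'] by blast
  let ?S = "{x \<in> V. q' (T x - z) < e}"
  show "openin (seminorm_topology V {q}) {x \<in> topspace (seminorm_topology V {q}). q' (T x - z) < e}"
    unfolding top
  proof (subst openin_subopen, intro ballI)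
    fix x assume x: "x \<in> ?S"
    \<comment> \<open>\<open>C\<close> may be zero or negative; \<open>\<bar>C\<bar> + 1\<close> is
      a positive bound in any case.\<close>
    define d where "d = (e - q' (T x - z)) / (\<bar>C\<bar> + 1)"
    have d: "0 < d" using x by (simp add: d_def)
    have "y \<in> ?S" if y: "y \<in> V" "q (y - x) < d" for y
    proof -
      have yx: "y - x \<in> V" using y x lin_closed_diff[OF V] by blast
      have "T y - z = (\<lambda>j. (T x - z) j + T (y - x) j)"
        using lin_on_diff[OF T(1), of y x] x y by auto
      then have "q' (T y - z) \<le> q' (T x - z) + q' (T (y - x))"
        using seminorm_on_triangle[OF Q(2)[OF q'] lin_closed_diff[OF V' T(2) z] T(2)[OF yx]] x
        by simp
      moreover have "q' (T (y - x)) \<le> (\<bar>C\<bar> + 1) * q (y - x)"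
        using C[OF yx] q yx mult_right_mono[of C "\<bar>C\<bar> + 1" "q (y - x)"]
        unfolding seminorm_on_def by fastforce
      moreover have "(\<bar>C\<bar> + 1) * q (y - x) < e - q' (T x - z)"
        using y(2) unfolding d_def by (simp add: pos_less_divide_eq mult.commute)
      ultimately show ?thesis using y(1) by simp
    qed
    moreover have "x \<in> {y \<in> V. q (y - x) < d}"
    proof -
      have "x - x = (\<lambda>_. 0)" by auto
      then show ?thesis using x d seminorm_on_zero[OF q] by simp
    qed
    ultimately show "\<exists>U. openin (seminorm_topology V {q}) U \<and> x \<in> U \<and> U \<subseteq> ?S"
      using openin_seminorm_ball[of q "{q}" x V d] x d by blast
  qed
qed

lemma continuous_map_into_proj_limit:
  assumes "\<X> \<noteq> {}" "\<And>Y. Y \<in> \<X> \<Longrightarrow> continuous_map X Y f"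
  shows "continuous_map X (proj_limit \<X>) f"
  unfolding proj_limit_def continuous_on_generated_topo_iff
proof (intro conjI allI impI)
  fix U assume "U \<in> {(\<Inter>X\<in>\<X>. topspace X) \<inter> U | X U. X \<in> \<X> \<and> openin X U}"
  then obtain Y W where Y: "Y \<in> \<X>" "openin Y W" and U: "U = (\<Inter>X\<in>\<X>. topspace X) \<inter> W" by blast
  have "f -` U \<inter> topspace X = {x \<in> topspace X. f x \<in> W}"
    using assms(2) unfolding U by (auto simp: continuous_map_def)
  then show "openin X (f -` U \<inter> topspace X)"
    using openin_continuous_map_preimage[OF assms(2)[OF Y(1)] Y(2)] by simp
next
  have "f ` topspace X \<subseteq> (\<Inter>X\<in>\<X>. topspace X)"
    using assms(2) by (auto simp: continuous_map_def)
  then show "f ` topspace X \<subseteq> \<Union> {(\<Inter>X\<in>\<X>. topspace X) \<inter> U | X U. X \<in> \<X> \<and> openin X U}"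
    using topspace_proj_limit[OF assms(1)]
    by (simp add: proj_limit_def topology_generated_by_topspace)
qed

lemma continuous_map_from_proj_limit:
  assumes "Y \<in> \<X>"
  shows "continuous_map (proj_limit \<X>) Y (\<lambda>x. x)"
  unfolding continuous_map_def
proof (intro conjI allI impI)
  have top: "topspace (proj_limit \<X>) = (\<Inter>X\<in>\<X>. topspace X)"
    using assms by (intro topspace_proj_limit) blast
  then show "(\<lambda>x. x) \<in> topspace (proj_limit \<X>) \<rightarrow> topspace Y" using assms by auto
  fix U assume U: "openin Y U"
  have "{x \<in> topspace (proj_limit \<X>). x \<in> U} = (\<Inter>X\<in>\<X>. topspace X) \<inter> U"
    using top by auto
  then show "openin (proj_limit \<X>) {x \<in> topspace (proj_limit \<X>). x \<in> U}"
    unfolding proj_limit_def using U assms by (auto intro!: topology_generated_by_Basis)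
qed

text \<open>Openness in the limit is tested by translates of neighbourhoods of 0, so the inclusion
  of a step is continuous once translations of that step are.\<close>

lemma continuous_map_into_ind_limit:
  assumes q: "seminorm_on V q" and X: "seminorm_topology V {q} \<in> \<X>"
    and top: "topspace (ind_limit \<X>) = (\<Union>X\<in>\<X>. topspace X)"
  shows "continuous_map (seminorm_topology V {q}) (ind_limit \<X>) (\<lambda>x. x)"
  unfolding continuous_map_def
proof (intro conjI allI impI)
  let ?X = "seminorm_topology V {q}"
  note V = seminorm_on_lin_closed[OF q]
  note topX = topspace_seminorm_topology_on[OF q]
  show "(\<lambda>x. x) \<in> topspace ?X \<rightarrow> topspace (ind_limit \<X>)" using X top by auto
  fix U assume U: "openin (ind_limit \<X>) U"
  show "openin ?X {x \<in> topspace ?X. x \<in> U}"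
  proof (subst openin_subopen, intro ballI)
    fix x assume "x \<in> {x \<in> topspace ?X. x \<in> U}"
    then have x: "x \<in> V" "x \<in> U" using topX by auto
    obtain W where W: "ind_limit_nhd0 \<X> W" "\<And>w. w \<in> W \<Longrightarrow> (\<lambda>i. x i + w i) \<in> U"
      using U x(2) unfolding openin_ind_limit ind_limit_open_def by blast
    obtain N where N: "openin ?X N" "(\<lambda>_. 0) \<in> N" "N \<subseteq> W"
      using W(1) X unfolding ind_limit_nhd0_def by blast
    \<comment> \<open>Translation by \<open>- x\<close> pulls the ball about \<open>z\<close> back
      to the ball about \<open>x + z\<close>.\<close>
    have "continuous_map ?X ?X (\<lambda>y. y - x)"
    proof (rule continuous_map_into_seminorm_topology)
      fix q' z and e :: real assume "q' \<in> {q}" "z \<in> V" "0 < e"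
      moreover have "(y - x) - z = y - (\<lambda>i. x i + z i)" for y by auto
      ultimately show "openin ?X {y \<in> topspace ?X. q' ((y - x) - z) < e}"
        using openin_seminorm_ball[of q "{q}" "\<lambda>i. x i + z i" V e] lin_closed_add[OF V x(1)]
        by (simp add: topX)
    qed (use topX x(1) lin_closed_diff[OF V] seminorm_on_zero[OF q] in auto)
    then have "openin ?X {y \<in> topspace ?X. y - x \<in> N}"
      using N(1) by (rule openin_continuous_map_preimage)
    moreover have "x - x = (\<lambda>_. 0)" by auto
    then have "x \<in> {y \<in> topspace ?X. y - x \<in> N}" using x(1) topX N(2) by simp
    moreover have "y \<in> U" if "y - x \<in> N" for y
    proof -
      have "(\<lambda>i. x i + (y - x) i) = y" by auto
      then show ?thesis using W(2)[of "y - x"] N(3) that by auto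
    qed
    then have "{y \<in> topspace ?X. y - x \<in> N} \<subseteq> {x \<in> topspace ?X. x \<in> U}" by auto
    ultimately show "\<exists>T. openin ?X T \<and> x \<in> T \<and> T \<subseteq> {x \<in> topspace ?X. x \<in> U}" by blast
  qed
qed

text \<open>For linear \<open>T\<close> the preimage under \<open>T\<close> of a seminorm ball about
  0 is absolutely convex, and continuity on each step makes it contain a neighbourhood of 0 there.
  These are the neighbourhoods that define the inductive limit.\<close>

lemma continuous_map_from_ind_limit:
  assumes lin: "lin_on (topspace (ind_limit \<X>)) T" and V: "lin_closed (topspace (ind_limit \<X>))"
    and top: "topspace (ind_limit \<X>) = (\<Union>X\<in>\<X>. topspace X)"
    and step0: "\<And>X. X \<in> \<X> \<Longrightarrow> (\<lambda>_. 0) \<in> topspace X"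
    and step: "\<And>X. X \<in> \<X> \<Longrightarrow> continuous_map X (seminorm_topology V' Q) T"
    and Q: "Q \<noteq> {}" "\<And>q. q \<in> Q \<Longrightarrow> seminorm_on V' q"
  shows "continuous_map (ind_limit \<X>) (seminorm_topology V' Q) T"
proof (rule continuous_map_into_seminorm_topology[OF Q(1)])
  let ?Y = "seminorm_topology V' Q"
  have topY: "topspace ?Y = V'"
    using topspace_seminorm_topology[OF Q(1)] Q(2) seminorm_on_zero by blast
  show 0: "q (\<lambda>_. 0) = 0" if "q \<in> Q" for q using Q(2)[OF that] by (rule seminorm_on_zero)
  show T: "T x \<in> V'" if "x \<in> topspace (ind_limit \<X>)" for x
    using that step topY unfolding top by (auto simp: continuous_map_def)
  fix q z and e :: real assume q: "q \<in> Q" and z: "z \<in> V'" and e: "0 < e"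
  note qs = Q(2)[OF q]
  note V' = seminorm_on_lin_closed[OF qs]
  let ?Z = "topspace (ind_limit \<X>)"
  have tri: "q (\<lambda>i. x i + y i) \<le> q x + q y" if "x \<in> V'" "y \<in> V'" for x y
    using qs that unfolding seminorm_on_def by blast
  have scale: "q (\<lambda>i. a * x i) = norm a * q x" if "x \<in> V'" for x a
    using qs that unfolding seminorm_on_def by blast
  show "openin (ind_limit \<X>) {x \<in> ?Z. q (T x - z) < e}"
    unfolding openin_ind_limit ind_limit_open_def
  proof (intro conjI ballI)
    show "{x \<in> ?Z. q (T x - z) < e} \<subseteq> (\<Union>X\<in>\<X>. topspace X)" using top by auto
    fix x assume x: "x \<in> {x \<in> ?Z. q (T x - z) < e}"
    \<comment> \<open>The distance left to the boundary of the ball; adding to \<open>x\<close> any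
      \<open>w\<close> with \<open>q (T w) < d\<close> keeps the image inside by the triangle
      inequality.\<close>
    define d where "d = e - q (T x - z)"
    have d: "0 < d" using x by (simp add: d_def)
    define W where "W = {w \<in> ?Z. q (T w) < d}"
    have "ind_limit_nhd0 \<X> W"
      unfolding ind_limit_nhd0_def
    proof (intro conjI ballI)
      show "W \<subseteq> (\<Union>X\<in>\<X>. topspace X)" using top by (auto simp: W_def)
      show "abs_convex W"
        unfolding abs_convex_def
      proof (intro ballI allI impI)
        fix x y and a b :: complex assume xy: "x \<in> W" "y \<in> W" and ab: "norm a + norm b \<le> 1"
        have Zx: "(\<lambda>i. a * x i + b * y i) \<in> ?Z"
          using V xy unfolding W_def lin_closed_def by blast
        have Txy: "T x \<in> V'" "T y \<in> V'" using xy T by (auto simp: W_def)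
        have "q (T (\<lambda>i. a * x i + b * y i)) = q (\<lambda>i. a * T x i + b * T y i)"
          using lin_on_comb[OF lin] xy by (simp add: W_def)
        also have "\<dots> \<le> norm a * q (T x) + norm b * q (T y)"
          using tri[OF lin_closed_scale[OF V' Txy(1)] lin_closed_scale[OF V' Txy(2)], of a b]
            scale[OF Txy(1)] scale[OF Txy(2)] by simp
        also have "\<dots> \<le> norm a * max (q (T x)) (q (T y)) + norm b * max (q (T x)) (q (T y))"
          by (intro add_mono mult_left_mono) auto
        also have "\<dots> = (norm a + norm b) * max (q (T x)) (q (T y))" by (simp add: distrib_right)
        also have "\<dots> \<le> 1 * max (q (T x)) (q (T y))"
          using qs Txy ab unfolding seminorm_on_def by (intro mult_right_mono) (auto simp: le_max_iff_disj)
        also have "\<dots> < d" using xy by (simp add: W_def)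
        finally show "(\<lambda>i. a * x i + b * y i) \<in> W" using Zx by (simp add: W_def)
      qed
      fix X assume X: "X \<in> \<X>"
      have "openin ?Y {y \<in> V'. q (y - (\<lambda>_. 0)) < d}"
        using V' q d by (intro openin_seminorm_ball) (auto simp: lin_closed_def)
      then have "openin X {x \<in> topspace X. T x \<in> {y \<in> V'. q (y - (\<lambda>_. 0)) < d}}"
        using step[OF X] by (rule openin_continuous_map_preimage[rotated])
      moreover have "y - (\<lambda>_. 0) = y" for y :: "'b \<Rightarrow> complex" by auto
      moreover have "T (\<lambda>_. 0) = (\<lambda>_. 0)"
        using lin_on_zero[OF lin] V by (auto simp: lin_closed_def)
      ultimately show "\<exists>N. openin X N \<and> (\<lambda>_. 0) \<in> N \<and> N \<subseteq> W"
        using step0[OF X] 0[OF q] d V' X top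
        by (intro exI[of _ "{x \<in> topspace X. T x \<in> {y \<in> V'. q (y - (\<lambda>_. 0)) < d}}"])
           (auto simp: W_def lin_closed_def)
    qed
    moreover have "(\<lambda>i. x i + w i) \<in> {x \<in> ?Z. q (T x - z) < e}" if w: "w \<in> W" for w
    proof -
      have xw: "x \<in> ?Z" "w \<in> ?Z" using x w by (auto simp: W_def)
      have "T (\<lambda>i. x i + w i) - z = (\<lambda>j. (T x - z) j + T w j)"
        using lin_on_add[OF lin xw] by auto
      then have "q (T (\<lambda>i. x i + w i) - z) \<le> q (T x - z) + q (T w)"
        using tri[OF lin_closed_diff[OF V' T[OF xw(1)] z] T[OF xw(2)]] by simp
      also have "\<dots> < e" using w by (simp add: W_def d_def)
      finally show ?thesis using lin_closed_add[OF V xw] by simp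
    qed
    ultimately show "\<exists>W. ind_limit_nhd0 \<X> W \<and> (\<forall>w\<in>W. (\<lambda>i. x i + w i) \<in> {x \<in> ?Z. q (T x - z) < e})"
      by blast
  qed
qed

section \<open>Separation by coordinates and convergence in generated topologies\<close>

lemma seminorm_on_coordinate: "seminorm_on UNIV (\<lambda>c. norm (c i))"
  by (simp add: seminorm_on_def lin_closed_def norm_mult norm_triangle_ineq)

text \<open>Two distinct families differ in some coordinate, and balls of half that difference in
  this coordinate are disjoint. Continuity of a coordinate is phrased through its seminorm so that
  the criteria for projective and inductive limits apply to it.\<close>

lemma Hausdorff_space_if_coordinates:
  assumes "\<And>i. continuous_map Y (seminorm_topology UNIV {\<lambda>c. norm (c i)}) (\<lambda>c. c)"
  shows "Hausdorff_space Y"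
  unfolding Hausdorff_space_def
proof (intro allI impI)
  fix x y assume xy: "x \<in> topspace Y \<and> y \<in> topspace Y \<and> x \<noteq> y"
  then obtain i where i: "x i \<noteq> y i" by (auto simp: fun_eq_iff)
  define e where "e = norm (x i - y i) / 2"
  have e: "0 < e" using i by (simp add: e_def)
  let ?B = "\<lambda>z. {c \<in> topspace Y. c \<in> {c \<in> UNIV. norm ((c - z) i) < e}}"
  have "openin Y (?B z)" for z
    by (rule openin_continuous_map_preimage[OF assms[of i]])
       (rule openin_seminorm_ball[of "\<lambda>c. norm (c i)"], auto simp: e)
  moreover have "disjnt (?B x) (?B y)"
  proof -
    have False if "norm (c i - x i) < e" "norm (c i - y i) < e" for c :: "'a \<Rightarrow> complex"
      using norm_triangle_ineq4[of "c i - y i" "c i - x i"] that by (simp add: e_def)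
    then show ?thesis by (auto simp: disjnt_iff)
  qed
  moreover have "x \<in> ?B x" "y \<in> ?B y" using xy e by auto
  ultimately show "\<exists>U V. openin Y U \<and> openin Y V \<and> x \<in> U \<and> y \<in> V \<and> disjnt U V" by blast
qed

lemma limitin_topology_generated_by:
  assumes l: "l \<in> \<Union>S" and ev: "\<And>U. U \<in> S \<Longrightarrow> l \<in> U \<Longrightarrow> eventually (\<lambda>n. f n \<in> U) F"
  shows "limitin (topology_generated_by S) f l F"
  unfolding limitin_def
proof (intro conjI allI impI)
  show "l \<in> topspace (topology_generated_by S)" using l by simp
  fix U assume "openin (topology_generated_by S) U \<and> l \<in> U"
  then have "generate_topology_on S U" "l \<in> U" by (auto simp: openin_topology_generated_by_iff)
  then show "eventually (\<lambda>n. f n \<in> U) F"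
  proof (induction rule: generate_topology_on.induct)
    case (UN K)
    then obtain k where "k \<in> K" "l \<in> k" by blast
    then show ?case using UN.IH[of k] by (auto elim: eventually_mono)
  qed (auto intro: ev eventually_conj)
qed

lemma limitin_seminorm_topology:
  assumes q: "seminorm_on V q" and l: "l \<in> V" and f: "\<And>n. f n \<in> V"
    and lim: "((\<lambda>n. q (f n - l)) \<longlongrightarrow> 0) F"
  shows "limitin (seminorm_topology V {q}) f l F"
  unfolding seminorm_topology_def
proof (rule limitin_topology_generated_by)
  show "l \<in> \<Union> {{y \<in> V. q' (y - x) < e} |q' x e. q' \<in> {q} \<and> x \<in> V \<and> 0 < e}"
    using topspace_seminorm_topology_on[OF q] l
    by (simp add: seminorm_topology_def topology_generated_by_topspace)
  fix U assume "U \<in> {{y \<in> V. q' (y - x) < e} |q' x e. q' \<in> {q} \<and> x \<in> V \<and> 0 < e}" and lU: "l \<in> U"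
  then obtain x e where x: "x \<in> V" and U: "U = {y \<in> V. q (y - x) < e}" by blast
  note V = seminorm_on_lin_closed[OF q]
  have "q (l - x) < e" using lU U by simp
  \<comment> \<open>The generating ball is centred at \<open>x\<close>, not at the limit
    \<open>l\<close>; what remains of its radius at \<open>l\<close> is
    \<open>e - q (l - x)\<close>.\<close>
  then have "eventually (\<lambda>n. q (f n - l) < e - q (l - x)) F"
    by (intro order_tendstoD(2)[OF lim]) simp
  then show "eventually (\<lambda>n. f n \<in> U) F"
  proof eventually_elim
    case (elim n)
    have "f n - x = (\<lambda>i. (f n - l) i + (l - x) i)" by auto
    then have "q (f n - x) \<le> q (f n - l) + q (l - x)"
      using seminorm_on_triangle[OF q lin_closed_diff[OF V f l] lin_closed_diff[OF V l x]] by simp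
    then show ?case using elim f U by simp
  qed
qed

lemma limitin_proj_limit:
  assumes "\<X> \<noteq> {}" "\<And>X. X \<in> \<X> \<Longrightarrow> limitin X f l F"
    and f: "\<And>n. f n \<in> (\<Inter>X\<in>\<X>. topspace X)"
  shows "limitin (proj_limit \<X>) f l F"
  unfolding proj_limit_def
proof (rule limitin_topology_generated_by)
  have "l \<in> topspace (proj_limit \<X>)"
    unfolding topspace_proj_limit[OF assms(1)] using assms(2) by (auto simp: limitin_def)
  then show "l \<in> \<Union> {(\<Inter>X\<in>\<X>. topspace X) \<inter> U | X U. X \<in> \<X> \<and> openin X U}"
    by (simp add: proj_limit_def topology_generated_by_topspace)
  fix U assume "U \<in> {(\<Inter>X\<in>\<X>. topspace X) \<inter> U | X U. X \<in> \<X> \<and> openin X U}" "l \<in> U"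
  then obtain X W where X: "X \<in> \<X>" "openin X W" "l \<in> W" and U: "U = (\<Inter>X\<in>\<X>. topspace X) \<inter> W" by blast
  then have "eventually (\<lambda>n. f n \<in> W) F" using assms(2)[OF X(1)] by (auto simp: limitin_def)
  then show "eventually (\<lambda>n. f n \<in> U) F" using f U by (auto elim: eventually_mono)
qed

lemma limitin_sequentially_closure_of:
  assumes "limitin X f l sequentially" "\<And>n. f n \<in> S"
  shows "l \<in> X closure_of S"
  unfolding in_closure_of
proof (intro conjI allI impI)
  show "l \<in> topspace X" using assms(1) by (simp add: limitin_def)
  fix T assume "l \<in> T \<and> openin X T"
  then have "eventually (\<lambda>n. f n \<in> T) sequentially" using assms(1) by (simp add: limitin_def)
  then obtain n where "f n \<in> T" using eventually_happens'[OF sequentially_bot] by blast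
  then show "\<exists>y. y \<in> S \<and> y \<in> T" using assms(2) by blast
qed


section \<open>Estimates for the kernel coefficients\<close>

lemma finite_mlen_le: "finite {\<alpha> :: 'n::finite \<Rightarrow> nat. mlen \<alpha> \<le> N}"
proof (rule finite_subset)
  have "\<alpha> j \<le> mlen \<alpha>" for \<alpha> :: "'n \<Rightarrow> nat" and j
    unfolding mlen_def by (rule member_le_sum) auto
  then show "{\<alpha> :: 'n \<Rightarrow> nat. mlen \<alpha> \<le> N} \<subseteq> Pi\<^sub>E UNIV (\<lambda>_. {..N})"
    by (auto intro: order_trans)
qed (auto intro: finite_PiE)

text \<open>Any finite set of multi-indices lies in a box, over which the sum factorises into
  geometric sums; their product bounds all partial sums uniformly.\<close>

lemma summable_on_power_mlen:
  fixes x :: real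
  assumes "0 \<le> x" "x < 1"
  shows "(\<lambda>\<alpha> :: 'n::finite \<Rightarrow> nat. x ^ mlen \<alpha>) summable_on UNIV"
proof (rule nonneg_bdd_above_summable_on)
  show "bdd_above (sum (\<lambda>\<alpha> :: 'n \<Rightarrow> nat. x ^ mlen \<alpha>) ` {F. F \<subseteq> UNIV \<and> finite F})"
  proof (rule bdd_aboveI2)
    fix F :: "('n \<Rightarrow> nat) set" assume "F \<in> {F. F \<subseteq> UNIV \<and> finite F}"
    then have F: "finite F" by simp
    define N where "N = (\<Sum>\<beta>\<in>F. mlen \<beta>)"
    have "\<alpha> j \<le> N" if "\<alpha> \<in> F" for \<alpha> j
    proof -
      have "\<alpha> j \<le> mlen \<alpha>" unfolding mlen_def by (rule member_le_sum) auto
      also have "\<dots> \<le> N" unfolding N_def by (rule member_le_sum) (use F that in auto)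
      finally show ?thesis .
    qed
    then have "F \<subseteq> Pi\<^sub>E UNIV (\<lambda>_. {..N})" by auto
    then have "(\<Sum>\<alpha>\<in>F. x ^ mlen \<alpha>) \<le> (\<Sum>\<alpha>\<in>Pi\<^sub>E (UNIV :: 'n set) (\<lambda>_. {..N}). x ^ mlen \<alpha>)"
      using assms by (intro sum_mono2) (auto intro: finite_PiE)
    also have "\<dots> = (\<Sum>\<alpha>\<in>Pi\<^sub>E (UNIV :: 'n set) (\<lambda>_. {..N}). \<Prod>j\<in>UNIV. x ^ \<alpha> j)"
      by (simp add: mlen_def power_sum)
    also have "\<dots> = (\<Prod>j\<in>(UNIV :: 'n set). \<Sum>k\<le>N. x ^ k)"
      by (rule prod_sum_PiE[symmetric]) auto
    also have "\<dots> \<le> (\<Prod>j\<in>(UNIV :: 'n set). 1 / (1 - x))"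
    proof (rule prod_mono)
      have "(\<Sum>k\<le>N. x ^ k) \<le> (\<Sum>k. x ^ k)"
        using assms by (intro sum_le_suminf summable_geometric) auto
      then show "0 \<le> (\<Sum>k\<le>N. x ^ k) \<and> (\<Sum>k\<le>N. x ^ k) \<le> 1 / (1 - x)"
        using assms by (simp add: suminf_geometric sum_nonneg)
    qed
    finally show "(\<Sum>\<alpha>\<in>F. x ^ mlen \<alpha>) \<le> (\<Prod>j\<in>(UNIV :: 'n set). 1 / (1 - x))" .
  qed
qed (use assms in auto)

text \<open>The universal comparison sequence: its q-th power is again geometric, with ratio
  \<open>x powr q\<close>.\<close>

lemma in_lp_power_mlen:
  assumes "1 \<le> p" "0 < x" "x < 1"
  shows "in_lp p (\<lambda>\<alpha> :: 'n::finite \<Rightarrow> nat. of_real (x ^ mlen \<alpha>))"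
proof (cases "p = \<infinity>")
  case True
  then show ?thesis
    using assms by (auto simp: in_lp_def bounded_iff norm_power intro!: exI[of _ 1] power_le_one)
next
  case False
  define q where "q = enn2real p"
  have q: "1 \<le> q" using enn2real_ge_1 assms False by (simp add: q_def)
  have "(\<lambda>\<alpha> :: 'n \<Rightarrow> nat. (x powr q) ^ mlen \<alpha>) summable_on UNIV"
    using assms q powr_less_mono2[of q x 1] by (intro summable_on_power_mlen) auto
  moreover have "norm (of_real (x ^ mlen \<alpha>) :: complex) powr q = (x powr q) ^ mlen \<alpha>" for \<alpha> :: "'n \<Rightarrow> nat"
    using assms by (simp add: norm_power powr_realpow[symmetric] powr_powr mult.commute)
  ultimately show ?thesis using False by (simp only: in_lp_def q_def if_False)
qed

section \<open>Lengths, factorials and binomials of multi-indices\<close>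

lemma mlen_mono: "\<alpha> \<le> \<beta> \<Longrightarrow> mlen \<alpha> \<le> mlen \<beta>"
  unfolding mlen_def by (rule sum_mono) (simp add: le_fun_def)

lemma mfact_mono: "\<alpha> \<le> \<beta> \<Longrightarrow> mfact \<alpha> \<le> mfact \<beta>"
  unfolding mfact_def by (rule prod_mono) (simp add: le_fun_def fact_mono)

lemma mlen_diff: "\<gamma> \<le> \<alpha> \<Longrightarrow> mlen (\<alpha> - \<gamma>) + mlen \<gamma> = mlen \<alpha>"
  unfolding mlen_def by (simp add: sum.distrib[symmetric] le_fun_def)

text \<open>In each coordinate the quotient is a binomial coefficient, a positive integer;
  divisibility gives the inequality.\<close>

lemma mfact_diff:
  assumes "\<gamma> \<le> \<alpha>"
  shows "mfact (\<alpha> - \<gamma>) * mfact \<gamma> \<le> mfact \<alpha>"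
  unfolding mfact_def prod.distrib[symmetric]
proof (rule prod_mono)
  fix j
  have "real (fact (\<alpha> j - \<gamma> j) * fact (\<gamma> j)) \<le> real (fact (\<alpha> j))"
    using assms by (subst of_nat_le_iff, intro dvd_imp_le)
      (auto simp: le_fun_def mult.commute choose_dvd)
  then show "0 \<le> fact ((\<alpha> - \<gamma>) j) * (fact (\<gamma> j) :: real) \<and>
      fact ((\<alpha> - \<gamma>) j) * fact (\<gamma> j) \<le> (fact (\<alpha> j) :: real)" by simp
qed

lemma mlen_case_sum: "mlen (case_sum \<alpha> \<beta>) = mlen \<alpha> + mlen \<beta>"
  unfolding mlen_def UNIV_Plus_UNIV[symmetric] by (simp add: sum.Plus del: UNIV_Plus_UNIV)

lemma mfact_case_sum: "mfact (case_sum \<alpha> \<beta>) = mfact \<alpha> * mfact \<beta>"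
  unfolding mfact_def UNIV_Plus_UNIV[symmetric] by (simp add: prod.Plus del: UNIV_Plus_UNIV)

lemma coef2_seq_case_sum: "coef2_seq a (case_sum \<alpha> \<beta>) = coef2 a \<alpha> \<beta>"
  by (simp add: coef2_seq_def comp_def)

lemma card_multiindices_le:
  fixes \<alpha> :: "'n::finite \<Rightarrow> nat"
  shows "finite {\<gamma>. \<gamma> \<le> \<alpha>}" "real (card {\<gamma>. \<gamma> \<le> \<alpha>}) \<le> 2 ^ mlen \<alpha>"
proof -
  have eq: "{\<gamma>. \<gamma> \<le> \<alpha>} = Pi\<^sub>E UNIV (\<lambda>j. {..\<alpha> j})" by (auto simp: le_fun_def)
  show "finite {\<gamma>. \<gamma> \<le> \<alpha>}" unfolding eq by (rule finite_PiE) auto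
  have "card {\<gamma>. \<gamma> \<le> \<alpha>} = (\<Prod>j\<in>UNIV. Suc (\<alpha> j))" unfolding eq by (simp add: card_PiE)
  also have "\<dots> \<le> (\<Prod>j\<in>UNIV. 2 ^ \<alpha> j)" by (intro prod_mono) (simp add: Suc_leI)
  also have "\<dots> = 2 ^ mlen \<alpha>" by (simp add: mlen_def power_sum)
  finally show "real (card {\<gamma>. \<gamma> \<le> \<alpha>}) \<le> 2 ^ mlen \<alpha>"
    by simp
qed

lemma mbinom_le: "mbinom \<alpha> \<gamma> \<le> 2 ^ mlen \<alpha>"
proof -
  have "mbinom \<alpha> \<gamma> \<le> (\<Prod>j\<in>UNIV. 2 ^ \<alpha> j)"
    unfolding mbinom_def by (intro prod_mono) (simp add: binomial_le_pow2)
  then show ?thesis by (simp add: mlen_def power_sum)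
qed

lemma mbinom_nonneg: "0 \<le> mbinom \<alpha> \<gamma>"
  unfolding mbinom_def by (rule prod_nonneg) simp

text \<open>The base 4 is 2 * 2: one factor bounds the number of \<gamma>, the other the square
  roots of the binomials.\<close>

lemma norm_kernel_coef_le:
  assumes "\<And>\<gamma>. \<gamma> \<le> \<alpha> \<Longrightarrow> \<gamma> \<le> \<beta> \<Longrightarrow> norm (coef2 a (\<alpha> - \<gamma>) (\<beta> - \<gamma>)) \<le> B" and B: "0 \<le> B"
  shows "norm (kernel_coef a \<alpha> \<beta>) \<le> 4 ^ (mlen \<alpha> + mlen \<beta>) * B"
proof -
  let ?G = "{\<gamma>. \<gamma> \<le> \<alpha> \<and> \<gamma> \<le> \<beta>}" and ?n = "mlen \<alpha> + mlen \<beta>"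
  have sqrt: "sqrt (mbinom \<alpha> \<gamma> * mbinom \<beta> \<gamma>) \<le> 2 ^ ?n" for \<gamma>
  proof -
    have "mbinom \<alpha> \<gamma> * mbinom \<beta> \<gamma> \<le> 2 ^ mlen \<alpha> * 2 ^ mlen \<beta>"
      by (intro mult_mono mbinom_le mbinom_nonneg) auto
    also have "\<dots> = 2 ^ ?n * 1" by (simp add: power_add)
    \<comment> \<open>Half of this exponent would do for the root; the generous bound keeps the
      exponents natural numbers.\<close>
    also have "\<dots> \<le> 2 ^ ?n * 2 ^ ?n" by (intro mult_left_mono) auto
    finally show ?thesis by (intro real_le_lsqrt) (auto simp: power2_eq_square)
  qed
  have "norm (kernel_coef a \<alpha> \<beta>) \<le> (\<Sum>\<gamma>\<in>?G. B * 2 ^ ?n)"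
    unfolding kernel_coef_def
  proof (intro order_trans[OF norm_sum] sum_mono)
    fix \<gamma> assume "\<gamma> \<in> ?G"
    then show "norm (coef2 a (\<alpha> - \<gamma>) (\<beta> - \<gamma>) * of_real (sqrt (mbinom \<alpha> \<gamma> * mbinom \<beta> \<gamma>))) \<le> B * 2 ^ ?n"
      unfolding norm_mult using assms(1)[of \<gamma>] sqrt[of \<gamma>] B
      by (intro mult_mono) (auto simp: mbinom_nonneg)
  qed
  also have "\<dots> = real (card ?G) * (B * 2 ^ ?n)" by simp
  also have "\<dots> \<le> 2 ^ ?n * (B * 2 ^ ?n)"
  proof (rule mult_right_mono)
    have "card ?G \<le> card {\<gamma>. \<gamma> \<le> \<alpha>}" by (rule card_mono) (use card_multiindices_le(1) in auto)
    then have "real (card ?G) \<le> 2 ^ mlen \<alpha>"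
      using card_multiindices_le(2)[of \<alpha>] by linarith
    also have "\<dots> \<le> 2 ^ ?n" by (rule power_increasing) auto
    finally show "real (card ?G) \<le> 2 ^ ?n" .
  qed (use B in auto)
  also have "\<dots> = 4 ^ ?n * B"
    by (simp add: power_mult_distrib[symmetric])
  finally show ?thesis .
qed

section \<open>Growth of the weights\<close>

lemma R_flat_le_half_cases:
  assumes "s \<in> R_flat" "s \<le> Num (1/2)"
  obtains t where "s = Num t" "0 < t" "t \<le> 1/2" | \<sigma> where "s = Flat \<sigma>" "0 < \<sigma>"
proof (cases s)
  case (Num t)
  then show ?thesis using assms that(1)[of t] by (auto simp: R_flat_def less_eq_flat_real_def)
next
  case (Flat \<sigma>)
  then show ?thesis using assms that(2)[of \<sigma>] by (auto simp: R_flat_def)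
qed

lemma add_powr_le:
  fixes x y q :: real
  assumes "0 \<le> x" "0 \<le> y" "0 \<le> q"
  shows "(x + y) powr q \<le> 2 powr q * (x powr q + y powr q)"
proof -
  have "(x + y) powr q \<le> (2 * max x y) powr q" by (rule powr_mono2) (use assms in auto)
  also have "\<dots> = 2 powr q * max x y powr q" by (rule powr_mult)
  also have "\<dots> \<le> 2 powr q * (x powr q + y powr q)" by (intro mult_left_mono) (auto simp: max_def)
  finally show ?thesis .
qed

lemma nat_le_powr:
  assumes "1 \<le> q"
  shows "real n \<le> real n powr q"
  using powr_mono[of 1 q "real n"] assms by (cases n) auto

text \<open>3 is log 8 rounded up, by e >= 2. It moves the geometric loss into the exponent of the
  weights with real index.\<close>

lemma eight_power_le_exp: "8 ^ n \<le> exp (3 * real n)"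
proof -
  have "2 ^ 3 \<le> exp (1::real) ^ 3" using exp_ge_add_one_self[of 1] by (intro power_mono) auto
  then have "8 \<le> exp (3::real)" by (simp add: exp_of_nat_mult[symmetric])
  then have "8 ^ n \<le> exp (3::real) ^ n" by (intro power_mono) auto
  then show ?thesis by (simp add: exp_of_nat_mult[symmetric] mult.commute)
qed

text \<open>This is where \<open>1 < q\<close>, that is s < 1/2, enters: the linear loss is absorbed
  for every r. Only \<open>r / 2\<close> is spent, the other half being reserved for the weight of
  the shifted index.\<close>

lemma linear_le_powr:
  assumes q: "1 < q" and r: "0 < r"
  obtains K where "\<And>n::nat. 3 * real n \<le> K + r / 2 * real n powr q"
proof
  fix n :: nat
  \<comment> \<open>Solves \<open>r * M powr (q - 1) = 6\<close>. Beyond \<open>M\<close> the power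
    alone dominates \<open>3 * n\<close>; up to \<open>M\<close> the constant \<open>3 * M\<close>
    does.\<close>
  define M where "M = (6 / r) powr (1 / (q - 1))"
  show "3 * real n \<le> 3 * (6 / r) powr (1 / (q - 1)) + r / 2 * real n powr q"
  proof (cases "real n \<le> M")
    case True
    then show ?thesis using r by (simp add: M_def add_increasing2)
  next
    case False
    have M: "0 < M" using r by (simp add: M_def)
    have n: "0 < real n" using False M by linarith
    have "6 / r = M powr (q - 1)" using r q by (simp add: M_def powr_powr)
    also have "\<dots> \<le> real n powr (q - 1)" using False M q by (intro powr_mono2) auto
    finally have "6 \<le> r * real n powr (q - 1)" using r by (simp add: pos_divide_le_eq mult.commute)
    then have "6 * real n \<le> r * real n powr (q - 1) * real n" using n by (intro mult_right_mono) auto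
    also have "real n powr (q - 1) = real n powr q / real n" using n by (simp add: powr_diff)
    finally have "3 * real n \<le> r / 2 * real n powr q" using n by simp
    then show ?thesis by (simp add: add_increasing)
  qed
qed

text \<open>Reduces the comparison to one inequality in a single natural number, applied to the
  lengths of \<alpha> and of \<beta>; hence \<open>2 * K\<close>. The factor
  \<open>2 powr (1/(2*t))\<close> is the price of splitting the power of a sum.\<close>

lemma weight_Num_pair_le:
  assumes \<gamma>: "\<gamma> \<le> \<alpha>" "\<gamma> \<le> \<beta>" and t: "0 < t" and \<rho>: "0 \<le> \<rho>"
    and lin: "\<And>n::nat. 3 * real n + \<rho> * 2 powr (1/(2*t)) * real n powr (1/(2*t)) \<le> K + r * real n powr (1/(2*t))"
  shows "8 ^ (mlen \<alpha> + mlen \<beta>) * weight \<rho> (Num t) (case_sum (\<alpha> - \<gamma>) (\<beta> - \<gamma>))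
      \<le> exp (2 * K) * weight r (Num t) \<alpha> * weight r (Num t) \<beta>"
proof -
  define q where "q = 1/(2*t)"
  have q: "0 < q" using t by (simp add: q_def)
  let ?a = "real (mlen \<alpha>)" and ?b = "real (mlen \<beta>)"
  have "real (mlen (case_sum (\<alpha> - \<gamma>) (\<beta> - \<gamma>))) \<le> ?a + ?b"
    using mlen_diff[OF \<gamma>(1)] mlen_diff[OF \<gamma>(2)] by (simp add: mlen_case_sum)
  then have "real (mlen (case_sum (\<alpha> - \<gamma>) (\<beta> - \<gamma>))) powr q \<le> (?a + ?b) powr q"
    using q by (intro powr_mono2) auto
  also have "\<dots> \<le> 2 powr q * (?a powr q + ?b powr q)" by (rule add_powr_le) (use q in auto)
  finally have "\<rho> * real (mlen (case_sum (\<alpha> - \<gamma>) (\<beta> - \<gamma>))) powr q \<le> \<rho> * (2 powr q * (?a powr q + ?b powr q))"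
    using \<rho> by (rule mult_left_mono)
  then have "3 * real (mlen \<alpha> + mlen \<beta>) + \<rho> * real (mlen (case_sum (\<alpha> - \<gamma>) (\<beta> - \<gamma>))) powr q
      \<le> 2 * K + r * ?a powr q + r * ?b powr q"
    using lin[of "mlen \<alpha>"] lin[of "mlen \<beta>"] unfolding q_def[symmetric] by (simp add: algebra_simps)
  then have "exp (3 * real (mlen \<alpha> + mlen \<beta>)) * exp (\<rho> * real (mlen (case_sum (\<alpha> - \<gamma>) (\<beta> - \<gamma>))) powr q)
      \<le> exp (2 * K) * exp (r * ?a powr q) * exp (r * ?b powr q)"
    by (simp add: exp_add[symmetric])
  moreover have "8 ^ (mlen \<alpha> + mlen \<beta>) * exp (\<rho> * real (mlen (case_sum (\<alpha> - \<gamma>) (\<beta> - \<gamma>))) powr q) \<le>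
      exp (3 * real (mlen \<alpha> + mlen \<beta>)) * exp (\<rho> * real (mlen (case_sum (\<alpha> - \<gamma>) (\<beta> - \<gamma>))) powr q)"
    by (intro mult_right_mono eight_power_le_exp) auto
  ultimately show ?thesis unfolding weight.simps q_def[symmetric] by (rule order_trans[rotated])
qed

text \<open>Multiplicativity lets the flat case treat \<alpha> and \<beta> separately.\<close>

lemma weight_Flat_case_sum:
  "weight \<rho> (Flat \<sigma>) (case_sum \<alpha> \<beta>) = weight \<rho> (Flat \<sigma>) \<alpha> * weight \<rho> (Flat \<sigma>) \<beta>"
  by (simp add: mlen_case_sum mfact_case_sum power_add powr_mult)

text \<open>A geometric loss costs flat weights nothing but a change of parameter.\<close>

lemma weight_Flat_scale: "k ^ mlen \<alpha> * weight \<rho> (Flat \<sigma>) \<alpha> = weight (k * \<rho>) (Flat \<sigma>) \<alpha>"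
  by (simp add: power_mult_distrib)

text \<open>Since \<open>y ^ n / n! \<le> exp y\<close>, the flat weights are bounded away from \<open>0\<close> even for small \<open>\<rho>\<close>.\<close>

lemma weight_Flat_ge:
  assumes "0 < \<rho>" "0 < \<sigma>"
  obtains C where "0 < C" "\<And>\<gamma> :: 'n::finite \<Rightarrow> nat. 1 \<le> C * weight \<rho> (Flat \<sigma>) \<gamma>"
proof
  define \<tau> where "\<tau> = 1 / (2 * \<sigma>)"
  \<comment> \<open>Chosen so that \<open>y powr \<tau> = 1 / \<rho>\<close>, which cancels the
    power of \<rho> in the weight.\<close>
  define y where "y = (1 / \<rho>) powr (1 / \<tau>)"
  have \<tau>: "0 < \<tau>" and y: "0 < y" using assms by (auto simp: \<tau>_def y_def)
  have y\<tau>: "y powr \<tau> = 1 / \<rho>" using \<tau> assms by (simp add: y_def powr_powr)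
  let ?E = "(\<Prod>j\<in>(UNIV :: 'n set). exp y)"
  show "0 < ?E powr \<tau>" by simp
  fix \<gamma> :: "'n \<Rightarrow> nat"
  have "y ^ mlen \<gamma> = (\<Prod>j\<in>UNIV. y ^ \<gamma> j)" by (simp add: mlen_def power_sum)
  also have "\<dots> \<le> (\<Prod>j\<in>UNIV. exp y * fact (\<gamma> j))"
  proof (intro prod_mono conjI)
    fix j
    have "y ^ \<gamma> j /\<^sub>R fact (\<gamma> j) \<le> (\<Sum>n. y ^ n /\<^sub>R fact n)"
      using sum_le_suminf[OF summable_exp_generic[of y], of "{\<gamma> j}"] y by simp
    then show "y ^ \<gamma> j \<le> exp y * fact (\<gamma> j)" by (simp add: exp_def field_simps)
  qed (use y in auto)
  also have "\<dots> = ?E * mfact \<gamma>" by (simp only: prod.distrib mfact_def)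
  finally have "(y ^ mlen \<gamma>) powr \<tau> \<le> (?E * mfact \<gamma>) powr \<tau>"
    using y \<tau> by (intro powr_mono2) auto
  moreover have "(y ^ mlen \<gamma>) powr \<tau> = (1 / \<rho>) ^ mlen \<gamma>"
    using y assms by (simp add: powr_realpow[symmetric] powr_powr mult.commute[of _ \<tau>] y\<tau>[symmetric])
  moreover have "(?E * mfact \<gamma>) powr \<tau> = ?E powr \<tau> * mfact \<gamma> powr \<tau>"
    by (rule powr_mult)
  ultimately have "(1 / \<rho>) ^ mlen \<gamma> \<le> ?E powr \<tau> * mfact \<gamma> powr \<tau>" by simp
  then have "\<rho> ^ mlen \<gamma> * (1 / \<rho>) ^ mlen \<gamma> \<le> \<rho> ^ mlen \<gamma> * (?E powr \<tau> * mfact \<gamma> powr \<tau>)"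
    using assms by (intro mult_left_mono) auto
  then show "1 \<le> ?E powr \<tau> * weight \<rho> (Flat \<sigma>) \<gamma>"
    using assms by (simp add: power_mult_distrib[symmetric] \<tau>_def mult.left_commute mult.assoc)
qed

text \<open>For \<rho> < 1 flat weights are not monotone in the multi-index. Splitting off the
  weight of \<gamma>, which is bounded below, replaces monotonicity.\<close>

lemma weight_Flat_diff:
  assumes "\<gamma> \<le> \<alpha>" "0 < \<rho>" "0 < \<sigma>"
  shows "weight \<rho> (Flat \<sigma>) (\<alpha> - \<gamma>) * weight \<rho> (Flat \<sigma>) \<gamma> \<le> weight \<rho> (Flat \<sigma>) \<alpha>"
proof -
  have "weight \<rho> (Flat \<sigma>) (\<alpha> - \<gamma>) * weight \<rho> (Flat \<sigma>) \<gamma> =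
      \<rho> ^ mlen \<alpha> * (mfact (\<alpha> - \<gamma>) * mfact \<gamma>) powr (1 / (2 * \<sigma>))"
    unfolding mlen_diff[OF assms(1), symmetric] by (simp add: power_add powr_mult)
  also have "\<dots> \<le> \<rho> ^ mlen \<alpha> * mfact \<alpha> powr (1 / (2 * \<sigma>))"
    using assms mfact_diff[OF assms(1)]
    by (intro mult_left_mono powr_mono2) (auto intro!: mult_nonneg_nonneg less_imp_le[OF mfact_pos])
  finally show ?thesis by simp
qed

text \<open>Here r is prescribed and \<rho> is chosen, as is possible for a symbol that satisfies
  its bound with every \<rho>. The base 8 is the 4 of the kernel sum times a spare 2.\<close>

lemma weight_growth_small:
  assumes s: "s \<in> R_flat" "s < Num (1/2)" and r: "0 < r"
  obtains \<rho> C where "0 < \<rho>" "0 \<le> C"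
    "\<And>\<alpha> \<beta> \<gamma> :: 'n::finite \<Rightarrow> nat. \<gamma> \<le> \<alpha> \<Longrightarrow> \<gamma> \<le> \<beta> \<Longrightarrow>
      8 ^ (mlen \<alpha> + mlen \<beta>) * weight \<rho> s (case_sum (\<alpha> - \<gamma>) (\<beta> - \<gamma>))
        \<le> C * weight r s \<alpha> * weight r s \<beta>"
  using s(1) less_imp_le[OF s(2)]
proof (cases rule: R_flat_le_half_cases)
  case (1 t)
  define q where "q = 1/(2*t)"
  have q: "1 < q" using 1 s by (simp add: q_def)
  obtain K where K: "\<And>n::nat. 3 * real n \<le> K + r / 2 * real n powr q"
    using linear_le_powr[OF q r] by blast
  show ?thesis
  proof (rule that)
    fix \<alpha> \<beta> \<gamma> :: "'n \<Rightarrow> nat" assume "\<gamma> \<le> \<alpha>" "\<gamma> \<le> \<beta>"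
    \<comment> \<open>Dividing by \<open>2 powr q\<close> cancels the loss from splitting the power
      of a sum. One half of r pays for the shifted weight, the other for the factor 8.\<close>
    then show "8 ^ (mlen \<alpha> + mlen \<beta>) * weight (r / 2 / 2 powr q) s (case_sum (\<alpha> - \<gamma>) (\<beta> - \<gamma>))
        \<le> exp (2 * K) * weight r s \<alpha> * weight r s \<beta>"
      unfolding 1(1)
    proof (rule weight_Num_pair_le)
      fix n :: nat
      show "3 * real n + r / 2 / 2 powr q * 2 powr (1/(2*t)) * real n powr (1/(2*t))
          \<le> K + r * real n powr (1/(2*t))"
        using K[of n] unfolding q_def[symmetric] by simp
    qed (use 1 r in auto)
  qed (use r in auto)
next
  case (2 \<sigma>)
  \<comment> \<open>Multiplying by 8 per unit of length turns the parameter \<open>r / 8\<close>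
    back into r.\<close>
  define \<rho> where "\<rho> = r / 8"
  have \<rho>: "0 < \<rho>" using r by (simp add: \<rho>_def)
  obtain C where C: "0 < C" "\<And>\<gamma> :: 'n \<Rightarrow> nat. 1 \<le> C * weight \<rho> (Flat \<sigma>) \<gamma>"
    using weight_Flat_ge[OF \<rho> 2(2)] by metis
  have le: "8 ^ mlen \<alpha> * weight \<rho> s (\<alpha> - \<gamma>) \<le> C * weight r s \<alpha>" if "\<gamma> \<le> \<alpha>" for \<alpha> \<gamma> :: "'n \<Rightarrow> nat"
  proof -
    have "weight \<rho> s (\<alpha> - \<gamma>) * 1 \<le> weight \<rho> s (\<alpha> - \<gamma>) * (C * weight \<rho> s \<gamma>)"
      using C(2)[of \<gamma>] less_imp_le[OF weight_pos[OF \<rho>]] unfolding 2(1) by (rule mult_left_mono)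
    also have "\<dots> \<le> C * weight \<rho> s \<alpha>"
      using weight_Flat_diff[OF that \<rho> 2(2)] C(1) unfolding 2(1)
      by (metis mult.left_commute mult_left_mono less_imp_le)
    finally have "8 ^ mlen \<alpha> * weight \<rho> s (\<alpha> - \<gamma>) \<le> 8 ^ mlen \<alpha> * (C * weight \<rho> s \<alpha>)"
      by (intro mult_left_mono) auto
    also have "\<dots> = C * (8 ^ mlen \<alpha> * weight \<rho> s \<alpha>)" by (rule mult.left_commute)
    also have "\<dots> = C * weight r s \<alpha>"
      unfolding 2(1) weight_Flat_scale by (simp add: \<rho>_def)
    finally show ?thesis .
  qed
  show ?thesis
  proof (rule that)
    fix \<alpha> \<beta> \<gamma> :: "'n \<Rightarrow> nat" assume \<gamma>: "\<gamma> \<le> \<alpha>" "\<gamma> \<le> \<beta>"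
    have "8 ^ (mlen \<alpha> + mlen \<beta>) * weight \<rho> s (case_sum (\<alpha> - \<gamma>) (\<beta> - \<gamma>)) =
        (8 ^ mlen \<alpha> * weight \<rho> s (\<alpha> - \<gamma>)) * (8 ^ mlen \<beta> * weight \<rho> s (\<beta> - \<gamma>))"
      unfolding 2(1) weight_Flat_case_sum power_add by (simp only: mult_ac)
    also have "\<dots> \<le> (C * weight r s \<alpha>) * (C * weight r s \<beta>)"
      using C(1) \<rho> r by (intro mult_mono[OF le[OF \<gamma>(1)] le[OF \<gamma>(2)]])
        (auto intro!: mult_nonneg_nonneg less_imp_le[OF weight_pos] simp del: weight.simps)
    finally show "8 ^ (mlen \<alpha> + mlen \<beta>) * weight \<rho> s (case_sum (\<alpha> - \<gamma>) (\<beta> - \<gamma>)) \<le>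
        C * C * weight r s \<alpha> * weight r s \<beta>" by (simp only: mult_ac)
  qed (use \<rho> C in auto)
qed

lemma weight_growth_large:
  assumes s: "s \<in> R_flat" "s \<le> Num (1/2)" and \<rho>: "0 < \<rho>"
  obtains r where "0 < r"
    "\<And>\<alpha> \<beta> \<gamma> :: 'n::finite \<Rightarrow> nat. \<gamma> \<le> \<alpha> \<Longrightarrow> \<gamma> \<le> \<beta> \<Longrightarrow>
      8 ^ (mlen \<alpha> + mlen \<beta>) * weight \<rho> s (case_sum (\<alpha> - \<gamma>) (\<beta> - \<gamma>))
        \<le> weight r s \<alpha> * weight r s \<beta>"
  using s
proof (cases rule: R_flat_le_half_cases)
  case (1 t)
  define q where "q = 1/(2*t)"
  have q: "1 \<le> q" using 1 s by (simp add: q_def)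
  \<comment> \<open>3 covers the factor 8, the rest covers the weight of the shifted index.\<close>
  define r where "r = 3 + \<rho> * 2 powr q"
  show ?thesis
  proof (rule that)
    show "0 < r" using \<rho> by (simp add: r_def add_pos_nonneg)
    fix \<alpha> \<beta> \<gamma> :: "'n \<Rightarrow> nat" assume "\<gamma> \<le> \<alpha>" "\<gamma> \<le> \<beta>"
    then have "8 ^ (mlen \<alpha> + mlen \<beta>) * weight \<rho> s (case_sum (\<alpha> - \<gamma>) (\<beta> - \<gamma>))
        \<le> exp (2 * 0) * weight r s \<alpha> * weight r s \<beta>"
      unfolding 1(1)
    proof (rule weight_Num_pair_le)
      fix n :: nat
      show "3 * real n + \<rho> * 2 powr (1/(2*t)) * real n powr (1/(2*t))
          \<le> 0 + r * real n powr (1/(2*t))"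
        using nat_le_powr[OF q, of n] unfolding q_def[symmetric] r_def by (simp add: distrib_right)
    qed (use 1 \<rho> in auto)
    then show "8 ^ (mlen \<alpha> + mlen \<beta>) * weight \<rho> s (case_sum (\<alpha> - \<gamma>) (\<beta> - \<gamma>))
        \<le> weight r s \<alpha> * weight r s \<beta>" by simp
  qed
next
  case (2 \<sigma>)
  \<comment> \<open>A parameter of at least 1 makes the flat weight monotone in the
    multi-index.\<close>
  define m where "m = max \<rho> 1"
  have m: "0 < m" "\<rho> \<le> m" "1 \<le> m" by (auto simp: m_def)
  have le: "8 ^ mlen \<alpha> * weight \<rho> s (\<alpha> - \<gamma>) \<le> weight (8 * m) s \<alpha>" if \<gamma>: "\<gamma> \<le> \<alpha>" for \<alpha> \<gamma> :: "'n \<Rightarrow> nat"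
  proof -
    have "weight \<rho> s (\<alpha> - \<gamma>) \<le> weight m s (\<alpha> - \<gamma>)" using \<rho> m by (intro weight_mono)
    also have "\<dots> \<le> weight m s \<alpha>"
      unfolding 2(1) weight.simps
    proof (intro mult_mono power_increasing powr_mono2)
      have "\<alpha> - \<gamma> \<le> \<alpha>" by (simp add: le_fun_def)
      then show "mlen (\<alpha> - \<gamma>) \<le> mlen \<alpha>" "mfact (\<alpha> - \<gamma>) \<le> mfact \<alpha>"
        by (auto intro: mlen_mono mfact_mono)
    qed (use m 2 less_imp_le[OF mfact_pos] in auto)
    finally have "8 ^ mlen \<alpha> * weight \<rho> s (\<alpha> - \<gamma>) \<le> 8 ^ mlen \<alpha> * weight m s \<alpha>"
      by (intro mult_left_mono) auto
    then show ?thesis unfolding 2(1) weight_Flat_scale .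
  qed
  show ?thesis
  proof (rule that)
    fix \<alpha> \<beta> \<gamma> :: "'n \<Rightarrow> nat" assume \<gamma>: "\<gamma> \<le> \<alpha>" "\<gamma> \<le> \<beta>"
    have "8 ^ (mlen \<alpha> + mlen \<beta>) * weight \<rho> s (case_sum (\<alpha> - \<gamma>) (\<beta> - \<gamma>)) =
        (8 ^ mlen \<alpha> * weight \<rho> s (\<alpha> - \<gamma>)) * (8 ^ mlen \<beta> * weight \<rho> s (\<beta> - \<gamma>))"
      unfolding 2(1) weight_Flat_case_sum power_add by (simp only: mult_ac)
    also have "\<dots> \<le> weight (8 * m) s \<alpha> * weight (8 * m) s \<beta>"
      using \<rho> m by (intro mult_mono le \<gamma>)
        (auto intro!: mult_nonneg_nonneg less_imp_le[OF weight_pos] simp del: weight.simps)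
    finally show "8 ^ (mlen \<alpha> + mlen \<beta>) * weight \<rho> s (case_sum (\<alpha> - \<gamma>) (\<beta> - \<gamma>)) \<le>
        weight (8 * m) s \<alpha> * weight (8 * m) s \<beta>" .
  qed (use m in auto)
qed

text \<open>Since the exponent grows at least linearly when s <= 1/2, halving the parameter gains a
  geometric factor: \<open>exp (- (r / 2))\<close> for real indices, 1/2 for flat ones. This drives
  the convergence of truncations.\<close>

lemma weight_half_le:
  assumes s: "s \<in> R_flat" "s \<le> Num (1/2)" and r: "0 < r"
  obtains x where "0 < x" "x < 1"
    "\<And>\<beta> :: 'n::finite \<Rightarrow> nat. weight (r / 2) s \<beta> \<le> x ^ mlen \<beta> * weight r s \<beta>"
  using s
proof (cases rule: R_flat_le_half_cases)
  case (1 t)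
  define q where "q = 1/(2*t)"
  have q: "1 \<le> q" using 1 by (simp add: q_def)
  show ?thesis
  proof (rule that)
    fix \<beta> :: "'n \<Rightarrow> nat"
    have "r / 2 * real (mlen \<beta>) \<le> r / 2 * real (mlen \<beta>) powr q"
      using nat_le_powr[OF q] r by (intro mult_left_mono) auto
    then have "exp (r / 2 * real (mlen \<beta>) powr q) \<le> exp (real (mlen \<beta>) * (- (r / 2)) + r * real (mlen \<beta>) powr q)"
      by (simp add: field_simps)
    also have "\<dots> = exp (- (r / 2)) ^ mlen \<beta> * exp (r * real (mlen \<beta>) powr q)"
      by (simp only: exp_add exp_of_nat_mult)
    finally show "weight (r / 2) s \<beta> \<le> exp (- (r / 2)) ^ mlen \<beta> * weight r s \<beta>"
      using 1 by (simp add: q_def)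
  qed (use r in auto)
next
  case (2 \<sigma>)
  show ?thesis
  proof (rule that)
    show "weight (r / 2) s \<beta> \<le> (1 / 2) ^ mlen \<beta> * weight r s \<beta>" for \<beta> :: "'n \<Rightarrow> nat"
      unfolding 2(1) weight_Flat_scale by simp
  qed auto
qed

text \<open>Of the 8 in the growth hypothesis, 4 cancels the kernel sum; the remaining 2 is
  distributed over \<alpha> and \<beta> as the decay that the matrix estimates need.\<close>

lemma kernel_coef_weight_le:
  assumes c: "\<And>\<alpha> \<beta>. norm (coef2 a \<alpha> \<beta>) \<le> A * weight \<rho> s (case_sum \<alpha> \<beta>)"
    and A: "0 \<le> A" and C: "0 \<le> C" and r: "0 < r"
    and w: "\<And>\<gamma>. \<gamma> \<le> \<alpha> \<Longrightarrow> \<gamma> \<le> \<beta> \<Longrightarrow>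
      8 ^ (mlen \<alpha> + mlen \<beta>) * weight \<rho> s (case_sum (\<alpha> - \<gamma>) (\<beta> - \<gamma>)) \<le> C * weight r s \<alpha> * weight r s \<beta>"
  shows "norm (kernel_coef a \<alpha> \<beta>) \<le>
      A * C * ((1/2) ^ mlen \<alpha> * weight r s \<alpha>) * ((1/2) ^ mlen \<beta> * weight r s \<beta>)"
proof -
  let ?n = "mlen \<alpha> + mlen \<beta>"
  let ?B = "A * (C * weight r s \<alpha> * weight r s \<beta> / 8 ^ ?n)"
  have "norm (kernel_coef a \<alpha> \<beta>) \<le> 4 ^ ?n * ?B"
  proof (rule norm_kernel_coef_le)
    fix \<gamma> assume "\<gamma> \<le> \<alpha>" "\<gamma> \<le> \<beta>"
    from w[OF this] have "weight \<rho> s (case_sum (\<alpha> - \<gamma>) (\<beta> - \<gamma>)) \<le> C * weight r s \<alpha> * weight r s \<beta> / 8 ^ ?n"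
      by (simp add: pos_le_divide_eq mult.commute del: weight.simps)
    then show "norm (coef2 a (\<alpha> - \<gamma>) (\<beta> - \<gamma>)) \<le> ?B"
      using c[of "\<alpha> - \<gamma>" "\<beta> - \<gamma>"] mult_left_mono[OF _ A] by fastforce
  qed (intro mult_nonneg_nonneg divide_nonneg_nonneg A C less_imp_le[OF weight_pos[OF r]], simp)
  also have "(8::real) ^ ?n = 4 ^ ?n * 2 ^ ?n" by (simp add: power_mult_distrib[symmetric])
  also have "4 ^ ?n * (A * (C * weight r s \<alpha> * weight r s \<beta> / (4 ^ ?n * 2 ^ ?n))) =
      A * C * ((1/2) ^ mlen \<alpha> * weight r s \<alpha>) * ((1/2) ^ mlen \<beta> * weight r s \<beta>)"
    by (simp add: power_add power_one_over field_simps del: weight.simps)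
  finally show ?thesis .
qed


section \<open>Matrix operators on weighted sequence spaces\<close>

text \<open>\<open>infsum\<close> gives 0 for a series that is not summable, so every use is
  accompanied by a proof of summability.\<close>

definition kernel_op ::
  "(('d \<Rightarrow> nat) \<Rightarrow> ('d \<Rightarrow> nat) \<Rightarrow> complex) \<Rightarrow> (('d::finite \<Rightarrow> nat) \<Rightarrow> complex) \<Rightarrow> ('d \<Rightarrow> nat) \<Rightarrow> complex" where
  "kernel_op K c \<alpha> = (\<Sum>\<^sub>\<infinity>\<beta>. K \<alpha> \<beta> * c \<beta>)"

lemma lin_on_kernel_op:
  assumes "\<And>c \<alpha>. c \<in> V \<Longrightarrow> (\<lambda>\<beta>. K \<alpha> \<beta> * c \<beta>) summable_on UNIV"
  shows "lin_on V (kernel_op K)"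
  unfolding lin_on_def
proof (intro ballI allI ext)
  fix x y a b \<alpha> assume xy: "x \<in> V" "y \<in> V"
  have "kernel_op K (\<lambda>i. a * x i + b * y i) \<alpha> =
      (\<Sum>\<^sub>\<infinity>\<beta>. a * (K \<alpha> \<beta> * x \<beta>) + b * (K \<alpha> \<beta> * y \<beta>))"
    unfolding kernel_op_def by (rule infsum_cong) (simp add: algebra_simps)
  also have "\<dots> = a * kernel_op K x \<alpha> + b * kernel_op K y \<alpha>"
    unfolding kernel_op_def
    by (simp only: infsum_add[OF summable_on_cmult_right[OF assms[OF xy(1)]]
          summable_on_cmult_right[OF assms[OF xy(2)]]] infsum_cmult_right')
  finally show "kernel_op K (\<lambda>i. a * x i + b * y i) \<alpha> = a * kernel_op K x \<alpha> + b * kernel_op K y \<alpha>" .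
qed

lemma
  fixes K :: "('d::finite \<Rightarrow> nat) \<Rightarrow> ('d \<Rightarrow> nat) \<Rightarrow> complex"
  assumes "finite S" "\<And>\<beta>. \<beta> \<notin> S \<Longrightarrow> c \<beta> = 0"
  shows kernel_op_summable_finite: "(\<lambda>\<beta>. K \<alpha> \<beta> * c \<beta>) summable_on UNIV"
    and kernel_op_finite: "kernel_op K c \<alpha> = (\<Sum>\<beta>\<in>S. K \<alpha> \<beta> * c \<beta>)"
proof -
  have "(\<lambda>\<beta>. K \<alpha> \<beta> * c \<beta>) summable_on UNIV \<longleftrightarrow> (\<lambda>\<beta>. K \<alpha> \<beta> * c \<beta>) summable_on S"
    by (rule summable_on_cong_neutral) (use assms in auto)
  then show "(\<lambda>\<beta>. K \<alpha> \<beta> * c \<beta>) summable_on UNIV" using assms by simp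
  have "kernel_op K c \<alpha> = (\<Sum>\<^sub>\<infinity>\<beta>\<in>S. K \<alpha> \<beta> * c \<beta>)"
    unfolding kernel_op_def by (rule infsum_cong_neutral) (use assms in auto)
  then show "kernel_op K c \<alpha> = (\<Sum>\<beta>\<in>S. K \<alpha> \<beta> * c \<beta>)" using assms by simp
qed

text \<open>Only the sup bound on the weighted input enters. The factor
  \<open>(1/2) ^ mlen \<beta>\<close> alone makes the series converge absolutely, for any p.\<close>

lemma
  fixes K :: "('d::finite \<Rightarrow> nat) \<Rightarrow> ('d \<Rightarrow> nat) \<Rightarrow> complex"
  assumes p: "1 \<le> p" and D: "0 \<le> D" and u: "\<And>\<alpha>. 0 < u \<alpha>" and \<theta>: "\<And>\<beta>. 0 < \<theta> \<beta>"
    and K: "\<And>\<alpha> \<beta>. norm (K \<alpha> \<beta>) \<le> D * ((1/2) ^ mlen \<alpha> * u \<alpha>) * ((1/2) ^ mlen \<beta> * \<theta> \<beta>)"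
    and c: "in_lp p (\<lambda>\<beta>. c \<beta> * of_real (\<theta> \<beta>))"
  shows kernel_op_summable: "(\<lambda>\<beta>. K \<alpha> \<beta> * c \<beta>) summable_on UNIV"
    and norm_kernel_op_le: "norm (kernel_op K c \<alpha>) \<le>
      D * ((1/2) ^ mlen \<alpha> * u \<alpha>) * lp_norm p (\<lambda>\<beta>. c \<beta> * of_real (\<theta> \<beta>)) *
        (\<Sum>\<^sub>\<infinity>\<beta> :: 'd \<Rightarrow> nat. (1/2) ^ mlen \<beta>)"
proof -
  let ?M = "lp_norm p (\<lambda>\<beta>. c \<beta> * of_real (\<theta> \<beta>))"
  let ?B = "D * ((1/2) ^ mlen \<alpha> * u \<alpha>) * ?M"
  have cM: "norm (c \<beta>) * \<theta> \<beta> \<le> ?M" for \<beta>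
    using norm_le_lp_norm[OF p c, of \<beta>] \<theta>[of \<beta>] by (simp add: norm_mult)
  have le: "norm (K \<alpha> \<beta> * c \<beta>) \<le> ?B * (1/2) ^ mlen \<beta>" for \<beta>
  proof -
    have "norm (K \<alpha> \<beta> * c \<beta>) \<le> D * ((1/2) ^ mlen \<alpha> * u \<alpha>) * ((1/2) ^ mlen \<beta> * \<theta> \<beta>) * norm (c \<beta>)"
      unfolding norm_mult using K by (intro mult_right_mono) auto
    also have "\<dots> = D * ((1/2) ^ mlen \<alpha> * u \<alpha>) * (1/2) ^ mlen \<beta> * (norm (c \<beta>) * \<theta> \<beta>)"
      by (simp only: mult_ac)
    also have "\<dots> \<le> D * ((1/2) ^ mlen \<alpha> * u \<alpha>) * (1/2) ^ mlen \<beta> * ?M"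
      using D less_imp_le[OF u] by (intro mult_left_mono cM) auto
    finally show ?thesis by (simp only: mult_ac)
  qed
  have sum: "(\<lambda>\<beta> :: 'd \<Rightarrow> nat. ?B * (1/2) ^ mlen \<beta>) summable_on UNIV"
    by (intro summable_on_cmult_right summable_on_power_mlen) auto
  then have abs: "(\<lambda>\<beta>. norm (K \<alpha> \<beta> * c \<beta>)) summable_on UNIV"
    by (rule summable_on_comparison_test) (use le in auto)
  then show "(\<lambda>\<beta>. K \<alpha> \<beta> * c \<beta>) summable_on UNIV" by (rule abs_summable_summable)
  have "norm (kernel_op K c \<alpha>) \<le> (\<Sum>\<^sub>\<infinity>\<beta>. norm (K \<alpha> \<beta> * c \<beta>))"
    unfolding kernel_op_def by (rule norm_infsum_bound[OF abs])
  also have "\<dots> \<le> (\<Sum>\<^sub>\<infinity>\<beta> :: 'd \<Rightarrow> nat. ?B * (1/2) ^ mlen \<beta>)" by (intro infsum_mono abs sum le)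
  also have "\<dots> = ?B * (\<Sum>\<^sub>\<infinity>\<beta> :: 'd \<Rightarrow> nat. (1/2) ^ mlen \<beta>)" by (rule infsum_cmult_right')
  finally show "norm (kernel_op K c \<alpha>) \<le> ?B * (\<Sum>\<^sub>\<infinity>\<beta> :: 'd \<Rightarrow> nat. (1/2) ^ mlen \<beta>)" .
qed

text \<open>The factor \<open>(1/2) ^ mlen \<alpha>\<close> left in the pointwise bound dominates
  the weighted output by a geometric sequence, which puts it into l^p with a norm linear in that of
  the input.\<close>

lemma continuous_map_kernel_op:
  fixes K :: "('d::finite \<Rightarrow> nat) \<Rightarrow> ('d \<Rightarrow> nat) \<Rightarrow> complex"
  assumes p: "1 \<le> p" and D: "0 \<le> D" and u: "\<And>\<alpha>. 0 < u \<alpha>" and \<theta>: "\<And>\<beta>. 0 < \<theta> \<beta>"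
    and K: "\<And>\<alpha> \<beta>. norm (K \<alpha> \<beta>) \<le> D * ((1/2) ^ mlen \<alpha> * u \<alpha>) * ((1/2) ^ mlen \<beta> * \<theta> \<beta>)"
  shows "continuous_map (weighted_lp p \<theta>) (weighted_lp p (\<lambda>\<alpha>. 1 / u \<alpha>)) (kernel_op K)"
proof -
  let ?S = "\<Sum>\<^sub>\<infinity>\<beta> :: 'd \<Rightarrow> nat. (1/2) ^ mlen \<beta> :: real"
  let ?g = "\<lambda>\<alpha> :: 'd \<Rightarrow> nat. complex_of_real ((1/2) ^ mlen \<alpha>)"
  have g: "in_lp p ?g" using p by (rule in_lp_power_mlen) auto
  have S: "0 \<le> ?S" by (rule infsum_nonneg) auto
  note bound = norm_kernel_op_le[OF p D u \<theta> K]
  have le: "norm (kernel_op K c \<alpha> * of_real (1 / u \<alpha>)) \<le>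
      (D * lp_norm p (\<lambda>\<beta>. c \<beta> * of_real (\<theta> \<beta>)) * ?S) * norm (?g \<alpha>)"
    if "in_lp p (\<lambda>\<beta>. c \<beta> * of_real (\<theta> \<beta>))" for c \<alpha>
    using bound[OF that, of \<alpha>] u[of \<alpha>]
    by (simp add: norm_mult norm_divide norm_power divide_le_eq abs_of_pos mult_ac)
  have nn: "0 \<le> D * lp_norm p (\<lambda>\<beta>. c \<beta> * of_real (\<theta> \<beta>)) * ?S"
    if "in_lp p (\<lambda>\<beta>. c \<beta> * of_real (\<theta> \<beta>))" for c
    using D S lp_norm_nonneg[OF that] by simp
  show ?thesis
    unfolding weighted_lp_def
  proof (rule continuous_map_seminorm_bounded)
    show "lin_on {c. in_lp p (\<lambda>i. c i * of_real (\<theta> i))} (kernel_op K)"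
      using kernel_op_summable[OF p D u \<theta> K] by (intro lin_on_kernel_op) auto
    show "kernel_op K c \<in> {c. in_lp p (\<lambda>i. c i * of_real (1 / u i))}"
      if "c \<in> {c. in_lp p (\<lambda>i. c i * of_real (\<theta> i))}" for c
      using in_lp_dominated[OF g le nn] that by simp
    fix q' assume "q' \<in> {\<lambda>c. lp_norm p (\<lambda>i. c i * of_real (1 / u i))}"
    then have q': "q' = (\<lambda>c. lp_norm p (\<lambda>i. c i * of_real (1 / u i)))" by blast
    show "seminorm_on {c. in_lp p (\<lambda>i. c i * of_real (1 / u i))} q'"
      unfolding q' by (rule seminorm_on_weighted_lp[OF p])
    show "\<exists>C. \<forall>c\<in>{c. in_lp p (\<lambda>i. c i * of_real (\<theta> i))}.
        q' (kernel_op K c) \<le> C * lp_norm p (\<lambda>i. c i * of_real (\<theta> i))"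
      unfolding q'
    proof (intro exI ballI)
      fix c assume "c \<in> {c. in_lp p (\<lambda>i. c i * of_real (\<theta> i))}"
      then show "lp_norm p (\<lambda>i. kernel_op K c i * of_real (1 / u i)) \<le>
          (D * ?S * lp_norm p ?g) * lp_norm p (\<lambda>i. c i * of_real (\<theta> i))"
        using lp_norm_dominated[OF p g le nn] by (simp add: mult_ac)
    qed
  qed (rule seminorm_on_weighted_lp[OF p], blast)
qed

lemma continuous_map_coordinate_weighted_lp:
  assumes p: "1 \<le> p" and \<theta>: "0 < \<theta> i"
  shows "continuous_map (weighted_lp p \<theta>) (seminorm_topology UNIV {\<lambda>c. norm (c i)}) (\<lambda>c. c)"
  unfolding weighted_lp_def
proof (rule continuous_map_seminorm_bounded)
  fix q' :: "('a \<Rightarrow> complex) \<Rightarrow> real" assume q': "q' \<in> {\<lambda>c. norm (c i)}"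
  show "\<exists>C. \<forall>c\<in>{c. in_lp p (\<lambda>i. c i * of_real (\<theta> i))}. q' c \<le> C * lp_norm p (\<lambda>i. c i * of_real (\<theta> i))"
  proof (intro exI ballI)
    fix c assume "c \<in> {c. in_lp p (\<lambda>i. c i * of_real (\<theta> i))}"
    then have "norm (c i * of_real (\<theta> i)) \<le> lp_norm p (\<lambda>i. c i * of_real (\<theta> i))"
      using norm_le_lp_norm[OF p, of "\<lambda>i. c i * of_real (\<theta> i)" i] by simp
    then show "q' c \<le> (1 / \<theta> i) * lp_norm p (\<lambda>i. c i * of_real (\<theta> i))"
      using q' \<theta> by (simp add: norm_mult field_simps)
  qed
qed (use seminorm_on_weighted_lp[OF p] seminorm_on_coordinate lin_on_ident in auto)

section \<open>Linear structure and separation of the limit spaces\<close>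

lemma topspace_ell_Union:
  "s \<noteq> Num 0 \<Longrightarrow> topspace (ell p s) = (\<Union>X\<in>{weighted_lp p (weight r s) | r. 0 < r}. topspace X)"
  by (auto simp: topspace_ell topspace_weighted_lp)

lemma topspace_ell0_dual_Union:
  "topspace (ell0_dual p s) = (\<Union>X\<in>{weighted_lp p (\<lambda>\<alpha>. 1 / weight r s \<alpha>) | r. 0 < r}. topspace X)"
  by (auto simp: topspace_ell0_dual topspace_weighted_lp)

lemma lin_closed_chain_Union:
  assumes "\<V> \<noteq> {}" "\<And>V. V \<in> \<V> \<Longrightarrow> lin_closed V"
    and dir: "\<And>V W. V \<in> \<V> \<Longrightarrow> W \<in> \<V> \<Longrightarrow> V \<subseteq> W \<or> W \<subseteq> V"
  shows "lin_closed (\<Union>\<V>)"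
  unfolding lin_closed_def
proof (intro conjI ballI allI)
  show "(\<lambda>_. 0) \<in> \<Union>\<V>" using assms(1,2) unfolding lin_closed_def by blast
  fix x y and a b :: complex assume "x \<in> \<Union>\<V>" "y \<in> \<Union>\<V>"
  then obtain V where V: "V \<in> \<V>" "x \<in> V" "y \<in> V" using dir by blast
  then show "(\<lambda>i. a * x i + b * y i) \<in> \<Union>\<V>" using assms(2)[OF V(1)] unfolding lin_closed_def by blast
qed

text \<open>The weights give spaces that shrink as r grows, their reciprocals spaces that grow; the
  disjunction covers both chains.\<close>

lemma lin_closed_weighted_lp_Union:
  assumes "\<And>r r'. 0 < r \<Longrightarrow> r \<le> r' \<Longrightarrow>
      topspace (weighted_lp p (\<theta> r)) \<subseteq> topspace (weighted_lp p (\<theta> r')) \<or>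
      topspace (weighted_lp p (\<theta> r')) \<subseteq> topspace (weighted_lp p (\<theta> r))"
  shows "lin_closed (\<Union>X\<in>{weighted_lp p (\<theta> r) | r :: real. 0 < r}. topspace X)"
  unfolding setcompr_pos_eq_image image_image
proof (rule lin_closed_chain_Union)
  fix V W assume "V \<in> (\<lambda>r. topspace (weighted_lp p (\<theta> r))) ` {0<..}"
    "W \<in> (\<lambda>r. topspace (weighted_lp p (\<theta> r))) ` {0<..}"
  then obtain r r' where r: "0 < r" "0 < r'" "V = topspace (weighted_lp p (\<theta> r))"
    "W = topspace (weighted_lp p (\<theta> r'))" by auto
  then show "V \<subseteq> W \<or> W \<subseteq> V"
    using assms[of r r'] assms[of r' r] by (cases "r \<le> r'") auto
qed (auto simp: lin_closed_weighted_lp)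

lemma lin_closed_ell: "s \<noteq> Num 0 \<Longrightarrow> lin_closed (topspace (ell p s))"
  unfolding topspace_ell_Union
  by (intro lin_closed_weighted_lp_Union disjI2 weighted_lp_mono) (simp add: abs_weight weight_mono)

lemma lin_closed_ell0_dual: "lin_closed (topspace (ell0_dual p s))"
  unfolding topspace_ell0_dual_Union
  by (intro lin_closed_weighted_lp_Union disjI1 weighted_lp_mono)
     (simp add: abs_weight weight_mono weight_pos frac_le)

lemma lin_closed_Inter: "(\<And>V. V \<in> \<V> \<Longrightarrow> lin_closed V) \<Longrightarrow> lin_closed (\<Inter>\<V>)"
  unfolding lin_closed_def by blast

lemma lin_closed_ell0: "lin_closed (topspace (ell0 p s :: (('n::finite \<Rightarrow> nat) \<Rightarrow> complex) topology))"
proof -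
  have "topspace (ell0 p s :: (('n \<Rightarrow> nat) \<Rightarrow> complex) topology) = (\<Inter>r\<in>{0<..}. topspace (weighted_lp p (weight r s)))"
    by (auto simp: topspace_ell0 topspace_weighted_lp)
  then show ?thesis by (simp only:) (rule lin_closed_Inter, auto simp: lin_closed_weighted_lp)
qed

lemma zero_in_weighted_lp: "(\<lambda>_. 0) \<in> topspace (weighted_lp p \<theta>)"
  using lin_closed_weighted_lp[of p \<theta>] by (simp add: lin_closed_def)

lemma Hausdorff_ell_dual:
  assumes "1 \<le> p" "s \<noteq> Num 0"
  shows "Hausdorff_space (ell_dual p s :: (('n::finite \<Rightarrow> nat) \<Rightarrow> complex) topology)"
proof (rule Hausdorff_space_if_coordinates)
  fix \<alpha> :: "'n \<Rightarrow> nat"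
  have "continuous_map (ell_dual p s) (weighted_lp p (\<lambda>\<alpha> :: 'n \<Rightarrow> nat. 1 / weight 1 s \<alpha>)) (\<lambda>c. c)"
    using assms unfolding ell_dual_def by (auto intro!: continuous_map_from_proj_limit exI[of _ 1])
  from continuous_map_compose[OF this continuous_map_coordinate_weighted_lp[OF assms(1), of _ \<alpha>]]
  show "continuous_map (ell_dual p s) (seminorm_topology UNIV {\<lambda>c. norm (c \<alpha>)}) (\<lambda>c. c)"
    by (simp add: weight_pos comp_def del: weight.simps)
qed

text \<open>Inductive limits do not inherit separation in general. Here each coordinate is linear
  and continuous on every step, hence continuous on the limit.\<close>

lemma Hausdorff_ell0_dual:
  assumes "1 \<le> p"
  shows "Hausdorff_space (ell0_dual p s :: (('n::finite \<Rightarrow> nat) \<Rightarrow> complex) topology)"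
proof (rule Hausdorff_space_if_coordinates)
  fix \<alpha> :: "'n \<Rightarrow> nat"
  show "continuous_map (ell0_dual p s) (seminorm_topology UNIV {\<lambda>c. norm (c \<alpha>)}) (\<lambda>c. c)"
    unfolding ell0_dual_def
  proof (rule continuous_map_from_ind_limit)
    fix X assume "X \<in> {weighted_lp p (\<lambda>\<alpha> :: 'n \<Rightarrow> nat. 1 / weight r s \<alpha>) | r. 0 < r}"
    then obtain r where "0 < r" "X = weighted_lp p (\<lambda>\<alpha>. 1 / weight r s \<alpha>)" by blast
    then show "continuous_map X (seminorm_topology UNIV {\<lambda>c. norm (c \<alpha>)}) (\<lambda>c. c)"
      and "(\<lambda>_. 0) \<in> topspace X"
      using assms by (auto intro!: continuous_map_coordinate_weighted_lp zero_in_weighted_lp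
          simp: weight_pos simp del: weight.simps)
  qed (use lin_closed_ell0_dual[of p s] topspace_ell0_dual_Union[of p s] seminorm_on_coordinate
        lin_on_ident in \<open>auto simp: ell0_dual_def[symmetric]\<close>)
qed

section \<open>Truncations and density of the finitely supported sequences\<close>

abbreviation finite_support :: "(('n::finite \<Rightarrow> nat) \<Rightarrow> complex) set" where
  "finite_support \<equiv> {c. finite {\<alpha>. c \<alpha> \<noteq> 0}}"

text \<open>Cutting by length yields a sequence of approximations, and also the projections in the
  seminorms of \<open>ell_dual p (Num 0)\<close>.\<close>

definition mtrunc :: "nat \<Rightarrow> (('n::finite \<Rightarrow> nat) \<Rightarrow> complex) \<Rightarrow> ('n \<Rightarrow> nat) \<Rightarrow> complex" where
  "mtrunc N c = (\<lambda>\<alpha>. if mlen \<alpha> \<le> N then c \<alpha> else 0)"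

lemma mtrunc_finite_support: "mtrunc N c \<in> finite_support"
  by (auto simp: mtrunc_def intro: finite_subset[OF _ finite_mlen_le[of N]] split: if_splits)

lemma in_lp_finite_support:
  fixes c :: "('n::finite \<Rightarrow> nat) \<Rightarrow> complex"
  assumes "1 \<le> p" "finite {\<alpha>. c \<alpha> \<noteq> 0}"
  shows "in_lp p c"
proof (rule in_lp_dominated)
  show "in_lp p (\<lambda>\<alpha> :: 'n \<Rightarrow> nat. of_real ((1/2) ^ mlen \<alpha>))" by (rule in_lp_power_mlen) (use assms in auto)
  let ?B = "\<Sum>\<beta> | c \<beta> \<noteq> 0. norm (c \<beta>) * 2 ^ mlen \<beta>"
  show "norm (c \<alpha>) \<le> ?B * norm (complex_of_real ((1/2) ^ mlen \<alpha>))" for \<alpha>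
  proof (cases "c \<alpha> = 0")
    case False
    have "norm (c \<alpha>) * 2 ^ mlen \<alpha> \<le> ?B" by (rule member_le_sum) (use False assms in auto)
    then show ?thesis by (simp add: norm_power norm_divide field_simps)
  qed (simp add: sum_nonneg)
qed (simp add: sum_nonneg)

lemma finite_support_weighted_lp:
  assumes "1 \<le> p" "c \<in> finite_support"
  shows "c \<in> topspace (weighted_lp p \<theta>)"
  unfolding topspace_weighted_lp
  using assms by (auto intro!: in_lp_finite_support elim: finite_subset[rotated])

text \<open>The geometric gain between the two weights replaces summability of tails, so p =
  \<infinity> is included.\<close>

lemma limitin_mtrunc:
  fixes c :: "('n::finite \<Rightarrow> nat) \<Rightarrow> complex"
  assumes p: "1 \<le> p" and c: "c \<in> topspace (weighted_lp p \<theta>')" and x: "0 < x" "x < 1"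
    and \<theta>: "\<And>\<alpha>. 0 < \<theta> \<alpha>" "\<And>\<alpha>. 0 < \<theta>' \<alpha>" "\<And>\<alpha>. \<theta> \<alpha> \<le> x ^ mlen \<alpha> * \<theta>' \<alpha>"
  shows "limitin (weighted_lp p \<theta>) (\<lambda>N. mtrunc N c) c sequentially"
proof -
  \<comment> \<open>Splits \<open>x ^ mlen \<alpha>\<close> into two equal factors: one becomes at
    most \<open>y ^ N\<close> on the tail and tends to 0, the other keeps the remainder dominated by
    an l^p sequence.\<close>
  define y where "y = sqrt x"
  have y: "0 < y" "y < 1" "x = y * y" using x by (auto simp: y_def)
  let ?g = "\<lambda>\<alpha> :: 'n \<Rightarrow> nat. complex_of_real (y ^ mlen \<alpha>)"
  have g: "in_lp p ?g" using p y by (intro in_lp_power_mlen) auto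
  let ?M = "lp_norm p (\<lambda>\<beta>. c \<beta> * of_real (\<theta>' \<beta>))"
  have c': "in_lp p (\<lambda>\<beta>. c \<beta> * of_real (\<theta>' \<beta>))" using c by (simp add: topspace_weighted_lp)
  have M: "0 \<le> ?M" by (rule lp_norm_nonneg[OF c'])
  have cM: "norm (c \<beta>) * \<theta>' \<beta> \<le> ?M" for \<beta>
    using norm_le_lp_norm[OF p c', of \<beta>] \<theta>(2)[of \<beta>] by (simp add: norm_mult)
  have "\<bar>\<theta> \<alpha>\<bar> \<le> \<bar>\<theta>' \<alpha>\<bar>" for \<alpha>
  proof -
    have "x ^ mlen \<alpha> * \<theta>' \<alpha> \<le> 1 * \<theta>' \<alpha>"
      using x \<theta>(2)[of \<alpha>] by (intro mult_right_mono power_le_one) auto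
    then show ?thesis using \<theta>(1)[of \<alpha>] \<theta>(2)[of \<alpha>] order_trans[OF \<theta>(3)] by simp
  qed
  from weighted_lp_mono[of \<theta> \<theta>' p, OF this] c have c\<theta>: "c \<in> topspace (weighted_lp p \<theta>)" by blast
  have le: "norm ((mtrunc N c - c) \<alpha> * of_real (\<theta> \<alpha>)) \<le> (?M * y ^ N) * norm (?g \<alpha>)" for N \<alpha>
  proof (cases "mlen \<alpha> \<le> N")
    case True
    then show ?thesis using M y by (simp add: mtrunc_def)
  next
    case False
    have "norm ((mtrunc N c - c) \<alpha> * of_real (\<theta> \<alpha>)) = norm (c \<alpha>) * \<theta> \<alpha>"
      using False \<theta>(1)[of \<alpha>] by (simp add: mtrunc_def norm_mult)
    also have "\<dots> \<le> norm (c \<alpha>) * (x ^ mlen \<alpha> * \<theta>' \<alpha>)" by (intro mult_left_mono \<theta>) auto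
    also have "\<dots> = (norm (c \<alpha>) * \<theta>' \<alpha>) * (y ^ mlen \<alpha> * y ^ mlen \<alpha>)"
      by (simp add: y(3) power_mult_distrib)
    also have "\<dots> \<le> ?M * (y ^ N * y ^ mlen \<alpha>)"
      using y False M by (intro mult_mono cM power_decreasing mult_right_mono) auto
    also have "\<dots> = (?M * y ^ N) * norm (?g \<alpha>)" using y by (simp add: norm_power)
    finally show ?thesis .
  qed
  have lim: "(\<lambda>N. lp_norm p (\<lambda>\<alpha>. (mtrunc N c - c) \<alpha> * of_real (\<theta> \<alpha>))) \<longlonglongrightarrow> 0"
  proof (rule tendsto_sandwich[where f = "\<lambda>_. 0" and h = "\<lambda>N. (?M * y ^ N) * lp_norm p ?g"])
    have "in_lp p (\<lambda>\<alpha>. (mtrunc N c - c) \<alpha> * of_real (\<theta> \<alpha>))" for N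
      by (rule in_lp_dominated[OF g le]) (use M y in auto)
    then show "\<forall>\<^sub>F N in sequentially. 0 \<le> lp_norm p (\<lambda>\<alpha>. (mtrunc N c - c) \<alpha> * of_real (\<theta> \<alpha>))"
      by (simp add: lp_norm_nonneg)
    show "\<forall>\<^sub>F N in sequentially. lp_norm p (\<lambda>\<alpha>. (mtrunc N c - c) \<alpha> * of_real (\<theta> \<alpha>)) \<le>
        (?M * y ^ N) * lp_norm p ?g"
      using M y by (intro always_eventually allI lp_norm_dominated[OF p g le]) auto
    have "(\<lambda>N. (?M * y ^ N) * lp_norm p ?g) \<longlonglongrightarrow> (?M * 0) * lp_norm p ?g"
      using y by (intro tendsto_intros LIMSEQ_realpow_zero) auto
    then show "(\<lambda>N. (?M * y ^ N) * lp_norm p ?g) \<longlonglongrightarrow> 0" by simp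
  qed simp
  show ?thesis
    unfolding weighted_lp_def
    using c\<theta> finite_support_weighted_lp[OF p mtrunc_finite_support, of _ _ \<theta>] lim
    by (intro limitin_seminorm_topology seminorm_on_weighted_lp[OF p])
       (simp_all add: topspace_weighted_lp)
qed

text \<open>Convergence takes place in the larger step with parameter \<open>r / 2\<close> and
  passes to the limit through the continuous inclusion.\<close>

lemma dense_ell:
  assumes p: "1 \<le> p" and s: "s \<in> R_flat" "s \<le> Num (1/2)"
    and c: "c \<in> topspace (ell p s :: (('n::finite \<Rightarrow> nat) \<Rightarrow> complex) topology)"
  shows "c \<in> ell p s closure_of finite_support"
proof (rule limitin_sequentially_closure_of[OF _ mtrunc_finite_support])
  have s0: "s \<noteq> Num 0" using s by (auto simp: R_flat_def)
  obtain r where r: "0 < r" "c \<in> topspace (weighted_lp p (weight r s))"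
    using c s0 by (auto simp: topspace_ell topspace_weighted_lp)
  obtain x where x: "0 < x" "x < 1" "\<And>\<beta> :: 'n \<Rightarrow> nat. weight (r / 2) s \<beta> \<le> x ^ mlen \<beta> * weight r s \<beta>"
    using weight_half_le[OF s r(1)] by blast
  have lim: "limitin (weighted_lp p (weight (r / 2) s)) (\<lambda>N. mtrunc N c) c sequentially"
    by (rule limitin_mtrunc[OF p r(2) x(1,2)]) (use r x in \<open>auto intro!: weight_pos simp del: weight.simps\<close>)
  have "continuous_map (weighted_lp p (weight (r / 2) s)) (ell p s :: (('n \<Rightarrow> nat) \<Rightarrow> complex) topology) (\<lambda>c. c)"
  proof -
    have "weighted_lp p (weight (r / 2) s :: ('n \<Rightarrow> nat) \<Rightarrow> real) \<in> {weighted_lp p (weight r s) | r. 0 < r}"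
      using r(1) by (intro CollectI exI[of _ "r / 2"]) simp
    then show ?thesis
      using continuous_map_into_ind_limit[OF seminorm_on_weighted_lp[OF p],
          of _ "{weighted_lp p (weight r s :: ('n \<Rightarrow> nat) \<Rightarrow> real) | r. 0 < r}"] topspace_ell_Union[OF s0, of p]
      unfolding weighted_lp_def[symmetric] ell_def by (simp only: s0 if_False)
  qed
  from continuous_map_limit[OF this lim]
  show "limitin (ell p s) (\<lambda>N. mtrunc N c) c sequentially" by (simp add: comp_def)
qed

text \<open>Membership for all parameters is used at \<open>2 * r\<close> to obtain convergence in
  the norm with parameter \<open>r\<close>.\<close>

lemma dense_ell0:
  assumes p: "1 \<le> p" and s: "s \<in> R_flat" "s \<le> Num (1/2)"
    and c: "c \<in> topspace (ell0 p s :: (('n::finite \<Rightarrow> nat) \<Rightarrow> complex) topology)"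
  shows "c \<in> ell0 p s closure_of finite_support"
proof (rule limitin_sequentially_closure_of[OF _ mtrunc_finite_support])
  show "limitin (ell0 p s) (\<lambda>N. mtrunc N c) c sequentially"
    unfolding ell0_def
  proof (rule limitin_proj_limit)
    fix X assume "X \<in> {weighted_lp p (weight r s :: ('n \<Rightarrow> nat) \<Rightarrow> real) | r. 0 < r}"
    then obtain r where r: "0 < r" and X: "X = weighted_lp p (weight r s)" by blast
    obtain x where x: "0 < x" "x < 1"
        "\<And>\<beta> :: 'n \<Rightarrow> nat. weight ((2 * r) / 2) s \<beta> \<le> x ^ mlen \<beta> * weight (2 * r) s \<beta>"
      using weight_half_le[OF s, of "2 * r"] r by auto
    have "c \<in> topspace (weighted_lp p (weight (2 * r) s))"
      using c r by (simp add: topspace_ell0 topspace_weighted_lp del: weight.simps)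
    then show "limitin X (\<lambda>N. mtrunc N c) c sequentially"
      unfolding X by (rule limitin_mtrunc[OF p _ x(1,2)]) (use r x in \<open>auto intro!: weight_pos simp del: weight.simps\<close>)
  next
    show "mtrunc N c \<in> (\<Inter>X\<in>{weighted_lp p (weight r s) | r. 0 < r}. topspace X)" for N
      using finite_support_weighted_lp[OF p mtrunc_finite_support] by blast
  qed (auto intro: exI[of _ 1])
qed


section \<open>Extension of the operator\<close>

lemma coef_comb: "coef (\<lambda>\<alpha>. a * F \<alpha> + b * G \<alpha>) = (\<lambda>\<alpha>. a * coef F \<alpha> + b * coef G \<alpha>)"
  by (auto simp: coef_def algebra_simps)

lemma series_of_coef_comb:
  "series_of_coef (\<lambda>\<alpha>. a * c \<alpha> + b * d \<alpha>) = (\<lambda>\<alpha>. a * series_of_coef c \<alpha> + b * series_of_coef d \<alpha>)"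
  by (auto simp: series_of_coef_def add_divide_distrib)

text \<open>Moves the question to sequence spaces along the bijection \<open>coef\<close>.
  Separation of \<open>Y\<close> is demanded only when \<open>D\<close> is a proper part, because
  for \<open>D = topspace X\<close> agreement on \<open>D\<close> already determines the
  map.\<close>

lemma extends_uniquely_pullback_coef:
  fixes X Y :: "(('d::finite \<Rightarrow> nat) \<Rightarrow> complex) topology"
  assumes D: "D \<subseteq> topspace X" and X: "lin_closed (topspace X)"
    and lin: "lin_on (topspace X) T" and cont: "continuous_map X Y T"
    and agree: "\<And>c. c \<in> D \<Longrightarrow> coef (L (series_of_coef c)) = T c"
    and dense: "topspace X \<subseteq> X closure_of D"
    and Y: "topspace X \<noteq> D \<Longrightarrow> Hausdorff_space Y"
  shows "extends_uniquely L (coef -` D) (pullback_topology UNIV coef X) (pullback_topology UNIV coef Y)"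
proof -
  let ?X = "pullback_topology UNIV (coef :: 'd power_series \<Rightarrow> _) X"
  let ?Y = "pullback_topology UNIV (coef :: 'd power_series \<Rightarrow> _) Y"
  \<comment> \<open>Restricted because the candidates in \<open>extends_uniquely\<close> are
    extensional functions.\<close>
  let ?T = "restrict (\<lambda>F. series_of_coef (T (coef F))) (topspace ?X)"
  have top: "topspace ?X = coef -` topspace X" by (simp add: topspace_pullback_topology)
  have "continuous_map ?X ?Y ?T"
  proof (rule continuous_map_eq)
    have "coef \<circ> (\<lambda>F. series_of_coef (T (coef F))) = T \<circ> (coef :: 'd power_series \<Rightarrow> _)" by auto
    then show "continuous_map ?X ?Y (\<lambda>F. series_of_coef (T (coef F)))"
      using continuous_map_pullback[OF cont, of UNIV coef] by (intro continuous_map_pullback') auto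
  qed auto
  moreover have "linear_on_series (topspace ?X) ?T"
    unfolding linear_on_series_def
  proof (intro ballI allI)
    fix F G and a b :: complex assume FG: "F \<in> topspace ?X" "G \<in> topspace ?X"
    \<comment> \<open>The combination must stay in the domain, where the restriction
      \<open>?T\<close> agrees with the formula.\<close>
    then have "(\<lambda>\<alpha>. a * coef F \<alpha> + b * coef G \<alpha>) \<in> topspace X"
      using X unfolding top lin_closed_def by blast
    then have "(\<lambda>\<alpha>. a * F \<alpha> + b * G \<alpha>) \<in> topspace ?X" by (simp add: top coef_comb)
    then show "?T (\<lambda>\<alpha>. a * F \<alpha> + b * G \<alpha>) = (\<lambda>\<alpha>. a * ?T F \<alpha> + b * ?T G \<alpha>)"
      using FG lin_on_comb[OF lin, of "coef F" "coef G"]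
      by (simp add: coef_comb series_of_coef_comb top)
  qed
  moreover have "?T F = L F" if "F \<in> coef -` D" for F
  proof -
    have "coef (L F) = T (coef F)" using agree[of "coef F"] that by simp
    then have "series_of_coef (T (coef F)) = L F" by (metis series_of_coef_coef)
    then show ?thesis using that D by (auto simp: top)
  qed
  moreover have "S = S'"
    if S: "S \<in> extensional (topspace ?X)" "continuous_map ?X ?Y S" "\<forall>F\<in>coef -` D. S F = L F"
      and S': "S' \<in> extensional (topspace ?X)" "continuous_map ?X ?Y S'" "\<forall>F\<in>coef -` D. S' F = L F"
    for S S'
  proof (rule extensionalityI[OF S(1) S'(1)])
    fix F assume F: "F \<in> topspace ?X"
    show "S F = S' F"
    proof (cases "topspace X = D")
      case True
      then show ?thesis using S(3) S'(3) F by (simp add: top)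
    next
      case False
      have inj: "inj (coef :: 'd power_series \<Rightarrow> _)"
        by (metis injI series_of_coef_coef)
      have "continuous_map ?Y Y coef" using continuous_map_pullback[OF continuous_map_id, of UNIV coef Y] by simp
      then have H: "Hausdorff_space ?Y"
        using Hausdorff_space_injective_preimage[OF Y[OF False]] inj_on_subset[OF inj] by blast
      \<comment> \<open>Continuity of the inverse of \<open>coef\<close> transports the density of
        \<open>D\<close>.\<close>
      have "continuous_map X ?X series_of_coef"
        by (rule continuous_map_pullback') (auto simp: comp_def)
      from continuous_map_image_closure_subset[OF this, of D]
      moreover have "coef F \<in> X closure_of D" using F dense by (auto simp: top)
      ultimately have "series_of_coef (coef F) \<in> ?X closure_of (series_of_coef ` D)" by blast
      then have "F \<in> ?X closure_of (series_of_coef ` D)" by simp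
      then show ?thesis
        by (rule forall_in_closure_of_eq[OF _ H S(2) S'(2)]) (use S(3) S'(3) in auto)
    qed
  qed
  moreover have "?T \<in> extensional (topspace ?X)" by simp
  moreover have "coef -` D \<subseteq> topspace ?X" using D by (auto simp: top)
  ultimately show ?thesis
    unfolding extends_uniquely_def by (intro conjI ex1I[of _ ?T]) blast+
qed

text \<open>On finite support the infinite sum collapses to the finite one in \<open>Op_V\<close>,
  so the matrix operator is indeed an extension.\<close>

lemma coef_Op_V:
  assumes "c \<in> finite_support"
  shows "coef (Op_V a (series_of_coef c)) = kernel_op (kernel_coef a) c"
  unfolding Op_V_def coef_series_of_coef
  by (intro ext kernel_op_finite[symmetric]) (use assms in auto)

lemma topspace_A_space_zero: "topspace (A_space p (Num 0)) = coef -` finite_support"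
  by (simp add: A_space_def topspace_pullback_topology topspace_ell_zero)

lemma coef2_weight_bound:
  assumes p: "1 \<le> p" and \<rho>: "0 < \<rho>"
    and a: "in_lp p (\<lambda>\<eta>. coef2_seq a \<eta> * of_real (1 / weight \<rho> s \<eta>))"
  obtains A where "0 \<le> A" "\<And>\<alpha> \<beta>. norm (coef2 a \<alpha> \<beta>) \<le> A * weight \<rho> s (case_sum \<alpha> \<beta>)"
proof
  let ?A = "lp_norm p (\<lambda>\<eta>. coef2_seq a \<eta> * of_real (1 / weight \<rho> s \<eta>))"
  show "0 \<le> ?A" by (rule lp_norm_nonneg[OF a])
  fix \<alpha> \<beta> :: "'a \<Rightarrow> nat"
  have w: "0 < weight \<rho> s (case_sum \<alpha> \<beta>)" by (rule weight_pos[OF \<rho>])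
  have "norm (coef2 a \<alpha> \<beta>) / weight \<rho> s (case_sum \<alpha> \<beta>) \<le> ?A"
    using norm_le_lp_norm[OF p a, of "case_sum \<alpha> \<beta>"] w
    by (simp add: coef2_seq_case_sum norm_mult norm_divide del: weight.simps)
  then show "norm (coef2 a \<alpha> \<beta>) \<le> ?A * weight \<rho> s (case_sum \<alpha> \<beta>)"
    using w by (simp add: pos_divide_le_eq del: weight.simps)
qed

text \<open>No growth of the symbol matters: a step of the source fixes finitely many columns, a
  seminorm of the target finitely many rows, and a finite block of the matrix is bounded.\<close>

lemma extends_uniquely_zero:
  fixes a :: "'d::finite sesqui_series"
  assumes p: "1 \<le> p"
  shows "extends_uniquely (Op_V a) (topspace (A_space p (Num 0))) (A_space p (Num 0)) (A_dual p (Num 0))"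
  unfolding topspace_A_space_zero unfolding A_space_def A_dual_def
proof (rule extends_uniquely_pullback_coef)
  let ?V = "\<lambda>N. {c :: ('d \<Rightarrow> nat) \<Rightarrow> complex. \<forall>\<alpha>. mlen \<alpha> > N \<longrightarrow> c \<alpha> = 0}"
  let ?K = "kernel_coef a"
  have V: "?V N \<subseteq> finite_support" for N
    by (auto intro!: finite_subset[OF _ finite_mlen_le[of N]] simp: not_less[symmetric])
  have fin: "c \<in> finite_support \<Longrightarrow> in_lp p c" for c :: "('d \<Rightarrow> nat) \<Rightarrow> complex"
    using in_lp_finite_support[OF p] by simp
  have linV: "lin_closed (?V N)" for N by (auto simp: lin_closed_def)
  have sV: "seminorm_on (?V N) (lp_norm p)" for N
    using seminorm_on_weighted_lp[OF p, of "\<lambda>_. 1"] V fin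
    by (intro seminorm_on_subset[OF _ linV, of "{c. in_lp p c}"]) auto
  have topV: "topspace (seminorm_topology (?V N) {lp_norm p}) = ?V N" for N
    by (rule topspace_seminorm_topology_on[OF sV])
  \<comment> \<open>Truncation is multiplication by a weight with values 0 and 1, so the seminorm
    properties follow from those of weighted l^p.\<close>
  have tr: "mtrunc M c = (\<lambda>\<alpha>. c \<alpha> * of_real (if mlen \<alpha> \<le> M then 1 else 0))"
    for M and c :: "('d \<Rightarrow> nat) \<Rightarrow> complex" by (auto simp: mtrunc_def)
  have "{c :: ('d \<Rightarrow> nat) \<Rightarrow> complex. in_lp p (mtrunc M c)} = UNIV" for M using fin[OF mtrunc_finite_support] by auto
  then have sQ: "seminorm_on UNIV (\<lambda>c :: ('d \<Rightarrow> nat) \<Rightarrow> complex. lp_norm p (mtrunc M c))" for M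
    using seminorm_on_weighted_lp[OF p, of "\<lambda>\<alpha> :: 'd \<Rightarrow> nat. if mlen \<alpha> \<le> M then 1 else 0"]
    unfolding tr[symmetric] by simp
  have linfin: "lin_on finite_support (kernel_op ?K)"
    by (rule lin_on_kernel_op, rule kernel_op_summable_finite) auto
  have top: "topspace (ell p (Num 0)) = (finite_support :: (('d \<Rightarrow> nat) \<Rightarrow> complex) set)" by (rule topspace_ell_zero)
  have ell: "ell p (Num 0) = ind_limit {seminorm_topology (?V N) {lp_norm p} | N. True}"
    by (simp add: ell_def)
  have Un: "finite_support = (\<Union>X\<in>{seminorm_topology (?V N) {lp_norm p} | N. True}. topspace X)"
  proof (intro equalityI subsetI)
    fix c :: "('d \<Rightarrow> nat) \<Rightarrow> complex" assume "c \<in> finite_support"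
    then have fin: "finite {\<alpha>. c \<alpha> \<noteq> 0}" by simp
    have "mlen \<alpha> \<le> (\<Sum>\<beta> | c \<beta> \<noteq> 0. mlen \<beta>)" if "c \<alpha> \<noteq> 0" for \<alpha>
      by (rule member_le_sum) (use fin that in auto)
    then have "c \<in> ?V (\<Sum>\<beta> | c \<beta> \<noteq> 0. mlen \<beta>)" by (auto simp: not_le[symmetric])
    then show "c \<in> (\<Union>X\<in>{seminorm_topology (?V N) {lp_norm p} | N. True}. topspace X)"
      using topV by blast
  qed (use topV V in blast)
  have lin_fin: "lin_closed (finite_support :: (('d \<Rightarrow> nat) \<Rightarrow> complex) set)"
    unfolding lin_closed_def
  proof (intro conjI ballI allI)
    fix x y :: "('d \<Rightarrow> nat) \<Rightarrow> complex" and a b :: complex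
    assume "x \<in> finite_support" "y \<in> finite_support"
    then have "finite ({\<alpha>. x \<alpha> \<noteq> 0} \<union> {\<alpha>. y \<alpha> \<noteq> 0})" by simp
    then have "finite {\<alpha>. a * x \<alpha> + b * y \<alpha> \<noteq> 0}" by (rule finite_subset[rotated]) auto
    then show "(\<lambda>i. a * x i + b * y i) \<in> finite_support" by simp
  qed simp
  show "finite_support \<subseteq> topspace (ell p (Num 0) :: (('d \<Rightarrow> nat) \<Rightarrow> complex) topology)" by (simp add: top)
  show "lin_closed (topspace (ell p (Num 0) :: (('d \<Rightarrow> nat) \<Rightarrow> complex) topology))" by (simp only: top lin_fin)
  show "lin_on (topspace (ell p (Num 0))) (kernel_op ?K)" by (simp only: top linfin)
  show "coef (Op_V a (series_of_coef c)) = kernel_op ?K c" if "c \<in> finite_support" for c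
    using that by (rule coef_Op_V)
  show "topspace (ell p (Num 0)) \<subseteq> ell p (Num 0) closure_of (finite_support :: (('d \<Rightarrow> nat) \<Rightarrow> complex) set)"
    unfolding top using closure_of_subset[of finite_support "ell p (Num 0)"] top by blast
  show "topspace (ell p (Num 0)) \<noteq> (finite_support :: (('d \<Rightarrow> nat) \<Rightarrow> complex) set) \<Longrightarrow>
      Hausdorff_space (ell_dual p (Num 0) :: (('d \<Rightarrow> nat) \<Rightarrow> complex) topology)"
    using top by blast
  show "continuous_map (ell p (Num 0)) (ell_dual p (Num 0)) (kernel_op ?K)"
  proof -
    have "continuous_map (ind_limit {seminorm_topology (?V N) {lp_norm p} | N. True})
        (seminorm_topology UNIV {\<lambda>c. lp_norm p (mtrunc M c) | M. True}) (kernel_op ?K)"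
    proof (rule continuous_map_from_ind_limit)
      fix X assume "X \<in> {seminorm_topology (?V N) {lp_norm p} | N. True}"
      then obtain N where X: "X = seminorm_topology (?V N) {lp_norm p}" by blast
      show "(\<lambda>_. 0) \<in> topspace X" unfolding X topV by simp
      show "continuous_map X (seminorm_topology UNIV {\<lambda>c. lp_norm p (mtrunc M c) | M. True}) (kernel_op ?K)"
        unfolding X
      proof (rule continuous_map_seminorm_bounded[OF sV])
        fix q assume "q \<in> {\<lambda>c :: ('d \<Rightarrow> nat) \<Rightarrow> complex. lp_norm p (mtrunc M c) | M. True}"
        then obtain M where q: "q = (\<lambda>c. lp_norm p (mtrunc M c))" by blast
        show "seminorm_on UNIV q" unfolding q by (rule sQ)
        let ?A = "{\<alpha> :: 'd \<Rightarrow> nat. mlen \<alpha> \<le> M}" and ?B = "{\<beta> :: 'd \<Rightarrow> nat. mlen \<beta> \<le> N}"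
        \<comment> \<open>The indicator of the rows in the block; a truncated output is dominated by
          a multiple of it.\<close>
        let ?g = "mtrunc M (\<lambda>_. 1) :: ('d \<Rightarrow> nat) \<Rightarrow> complex"
        define C where "C = (\<Sum>\<alpha>\<in>?A. \<Sum>\<beta>\<in>?B. norm (?K \<alpha> \<beta>))"
        have C: "0 \<le> C" by (simp add: C_def sum_nonneg)
        have g: "in_lp p ?g" by (rule fin[OF mtrunc_finite_support])
        show "\<exists>C. \<forall>c\<in>?V N. q (kernel_op ?K c) \<le> C * lp_norm p c"
        proof (intro exI ballI)
          fix c :: "('d \<Rightarrow> nat) \<Rightarrow> complex" assume c: "c \<in> ?V N"
          have lpc: "in_lp p c" using c V fin by blast
          have M: "0 \<le> lp_norm p c" by (rule lp_norm_nonneg[OF lpc])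
          have le: "norm (mtrunc M (kernel_op ?K c) \<alpha>) \<le> (C * lp_norm p c) * norm (?g \<alpha>)" for \<alpha>
          proof (cases "mlen \<alpha> \<le> M")
            case True
            have "norm (kernel_op ?K c \<alpha>) = norm (\<Sum>\<beta>\<in>?B. ?K \<alpha> \<beta> * c \<beta>)"
              using c by (subst kernel_op_finite[OF finite_mlen_le[of N]]) auto
            also have "\<dots> \<le> (\<Sum>\<beta>\<in>?B. norm (?K \<alpha> \<beta>) * lp_norm p c)"
              by (intro order_trans[OF norm_sum] sum_mono)
                 (simp add: norm_mult mult_left_mono norm_le_lp_norm[OF p lpc])
            also have "\<dots> = (\<Sum>\<beta>\<in>?B. norm (?K \<alpha> \<beta>)) * lp_norm p c" by (rule sum_distrib_right[symmetric])
            also have "\<dots> \<le> C * lp_norm p c"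
              unfolding C_def using True M
              by (intro mult_right_mono member_le_sum[of \<alpha> ?A "\<lambda>\<alpha>. \<Sum>\<beta>\<in>?B. norm (?K \<alpha> \<beta>)"])
                 (auto simp: sum_nonneg finite_mlen_le)
            finally show ?thesis using True by (simp add: mtrunc_def)
          qed (simp add: mtrunc_def)
          show "q (kernel_op ?K c) \<le> (C * lp_norm p ?g) * lp_norm p c"
            unfolding q using lp_norm_dominated[OF p g le] C M by (simp add: mult_ac)
        qed
      qed (use lin_on_subset[OF linfin V] in auto)
    next
      let ?\<X> = "{seminorm_topology (?V N) {lp_norm p} | N. True}"
      have topi: "topspace (ind_limit ?\<X>) = finite_support" using top unfolding ell .
      show "lin_on (topspace (ind_limit ?\<X>)) (kernel_op ?K)" unfolding topi by (rule linfin)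
      show "lin_closed (topspace (ind_limit ?\<X>))" unfolding topi by (rule lin_fin)
      show "topspace (ind_limit ?\<X>) = (\<Union>X\<in>?\<X>. topspace X)" unfolding topi by (rule Un)
    qed (use sQ in auto)
    then show ?thesis by (simp add: ell ell_dual_def mtrunc_def)
  qed
qed

text \<open>Every step of the source must map continuously into every normed space of the target, so
  the matrix bound is required for all pairs \<open>r\<close>, \<open>r'\<close>.\<close>

lemma extends_uniquely_A:
  fixes a :: "'d::finite sesqui_series"
  assumes p: "1 \<le> p" and s: "s \<in> R_flat" "s < Num (1/2)" and a: "a \<in> topspace (A_tilde_dual p s)"
  shows "extends_uniquely (Op_V a) (topspace (A_space p (Num 0))) (A_space p s) (A_dual p s)"
  unfolding topspace_A_space_zero unfolding A_space_def A_dual_def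
proof (rule extends_uniquely_pullback_coef)
  let ?K = "kernel_coef a"
  have s0: "s \<noteq> Num 0" using s by (auto simp: R_flat_def)
  have ca: "in_lp p (\<lambda>\<eta>. coef2_seq a \<eta> * of_real (1 / weight \<rho> s \<eta>))" if "0 < \<rho>" for \<rho>
    using a s0 that
    by (simp add: A_tilde_dual_def topspace_pullback_topology topspace_ell_dual del: weight.simps)
  have bound: "\<exists>D\<ge>0. \<forall>\<alpha> \<beta>. norm (?K \<alpha> \<beta>) \<le>
      D * ((1/2) ^ mlen \<alpha> * weight r' s \<alpha>) * ((1/2) ^ mlen \<beta> * weight r s \<beta>)"
    if rr: "0 < r" "0 < r'" for r r'
  proof -
    \<comment> \<open>One parameter below both; the weights increase with it, so the bound with
      \<open>m\<close> on both sides implies the required one.\<close>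
    define m where "m = min r r'"
    have m: "0 < m" "m \<le> r" "m \<le> r'" using rr by (auto simp: m_def)
    obtain \<rho> C where \<rho>: "0 < \<rho>" and C: "0 \<le> C"
      and w: "\<And>\<alpha> \<beta> \<gamma> :: 'd \<Rightarrow> nat. \<gamma> \<le> \<alpha> \<Longrightarrow> \<gamma> \<le> \<beta> \<Longrightarrow>
        8 ^ (mlen \<alpha> + mlen \<beta>) * weight \<rho> s (case_sum (\<alpha> - \<gamma>) (\<beta> - \<gamma>))
          \<le> C * weight m s \<alpha> * weight m s \<beta>"
      using weight_growth_small[OF s m(1)] by metis
    obtain A where A: "0 \<le> A" "\<And>\<alpha> \<beta>. norm (coef2 a \<alpha> \<beta>) \<le> A * weight \<rho> s (case_sum \<alpha> \<beta>)"
      using coef2_weight_bound[OF p \<rho> ca[OF \<rho>]] by metis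
    show ?thesis
    proof (intro exI[of _ "A * C"] conjI allI)
      show "0 \<le> A * C" using A C by simp
      fix \<alpha> \<beta> :: "'d \<Rightarrow> nat"
      have "norm (?K \<alpha> \<beta>) \<le> A * C * ((1/2) ^ mlen \<alpha> * weight m s \<alpha>) * ((1/2) ^ mlen \<beta> * weight m s \<beta>)"
        by (rule kernel_coef_weight_le[OF A(2,1) C m(1) w])
      also have "\<dots> \<le> A * C * ((1/2) ^ mlen \<alpha> * weight r' s \<alpha>) * ((1/2) ^ mlen \<beta> * weight r s \<beta>)"
        using A C m rr by (intro mult_mono mult_left_mono weight_mono)
          (auto intro!: mult_nonneg_nonneg less_imp_le[OF weight_pos] simp del: weight.simps)
      finally show "norm (?K \<alpha> \<beta>) \<le> A * C * ((1/2) ^ mlen \<alpha> * weight r' s \<alpha>) * ((1/2) ^ mlen \<beta> * weight r s \<beta>)" .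
    qed
  qed
  have step: "continuous_map (weighted_lp p (weight r s)) (weighted_lp p (\<lambda>\<alpha>. 1 / weight r' s \<alpha>)) (kernel_op ?K)"
    if rr: "0 < r" "0 < r'" for r r'
  proof -
    obtain D where D: "0 \<le> D" "\<And>\<alpha> \<beta>. norm (?K \<alpha> \<beta>) \<le>
        D * ((1/2) ^ mlen \<alpha> * weight r' s \<alpha>) * ((1/2) ^ mlen \<beta> * weight r s \<beta>)"
      using bound[OF rr] by metis
    show ?thesis
      by (rule continuous_map_kernel_op[OF p D(1) weight_pos[OF rr(2)] weight_pos[OF rr(1)] D(2)])
  qed
  show lin: "lin_on (topspace (ell p s)) (kernel_op ?K)"
  proof (rule lin_on_kernel_op)
    fix c \<alpha> assume "c \<in> topspace (ell p s :: (('d \<Rightarrow> nat) \<Rightarrow> complex) topology)"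
    then obtain r where r: "0 < r" "in_lp p (\<lambda>\<alpha>. c \<alpha> * of_real (weight r s \<alpha>))"
      using topspace_ell[OF s0] by blast
    obtain D where D: "0 \<le> D" "\<And>\<alpha> \<beta>. norm (?K \<alpha> \<beta>) \<le>
        D * ((1/2) ^ mlen \<alpha> * weight r s \<alpha>) * ((1/2) ^ mlen \<beta> * weight r s \<beta>)"
      using bound[OF r(1) r(1)] by metis
    show "(\<lambda>\<beta>. ?K \<alpha> \<beta> * c \<beta>) summable_on UNIV"
      by (rule kernel_op_summable[OF p D(1) weight_pos[OF r(1)] weight_pos[OF r(1)] D(2) r(2)])
  qed
  have top: "topspace (ell p s) =
      (\<Union>X\<in>{weighted_lp p (weight r s :: ('d \<Rightarrow> nat) \<Rightarrow> real) | r. 0 < r}. topspace X)"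
    by (rule topspace_ell_Union[OF s0])
  have ell: "ell p s = ind_limit {weighted_lp p (weight r s :: ('d \<Rightarrow> nat) \<Rightarrow> real) | r. 0 < r}"
    using s0 by (simp add: ell_def)
  show linc: "lin_closed (topspace (ell p s :: (('d \<Rightarrow> nat) \<Rightarrow> complex) topology))"
    by (rule lin_closed_ell[OF s0])
  show "continuous_map (ell p s) (ell_dual p s) (kernel_op ?K)"
    unfolding ell_dual_def if_not_P[OF s0]
  proof (rule continuous_map_into_proj_limit)
    fix Y assume "Y \<in> {weighted_lp p (\<lambda>\<alpha> :: 'd \<Rightarrow> nat. 1 / weight r s \<alpha>) | r. 0 < r}"
    then obtain r' where r': "0 < r'" and Y: "Y = weighted_lp p (\<lambda>\<alpha>. 1 / weight r' s \<alpha>)" by blast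
    show "continuous_map (ell p s) Y (kernel_op ?K)"
      unfolding Y ell weighted_lp_def[of p "\<lambda>\<alpha>. 1 / weight r' s \<alpha>"]
    proof (rule continuous_map_from_ind_limit)
      fix X assume "X \<in> {weighted_lp p (weight r s :: ('d \<Rightarrow> nat) \<Rightarrow> real) | r. 0 < r}"
      then obtain r where r: "0 < r" and X: "X = weighted_lp p (weight r s)" by blast
      show "(\<lambda>_. 0) \<in> topspace X" unfolding X by (rule zero_in_weighted_lp)
      show "continuous_map X (seminorm_topology {c. in_lp p (\<lambda>i. c i * of_real (1 / weight r' s i))}
          {\<lambda>c. lp_norm p (\<lambda>i. c i * of_real (1 / weight r' s i))}) (kernel_op ?K)"
        using step[OF r r'] unfolding X weighted_lp_def[of p "\<lambda>\<alpha>. 1 / weight r' s \<alpha>"] .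
    next
      fix q assume "q \<in> {\<lambda>c :: ('d \<Rightarrow> nat) \<Rightarrow> complex. lp_norm p (\<lambda>i. c i * of_real (1 / weight r' s i))}"
      then have q: "q = (\<lambda>c. lp_norm p (\<lambda>i. c i * of_real (1 / weight r' s i)))" by blast
      show "seminorm_on {c. in_lp p (\<lambda>i. c i * of_real (1 / weight r' s i))} q"
        unfolding q by (rule seminorm_on_weighted_lp[OF p])
    qed (use lin linc top in \<open>simp_all only: ell[symmetric]\<close>, blast)
  qed (auto intro: exI[of _ 1])
  show "topspace (ell p s) \<subseteq> ell p s closure_of (finite_support :: (('d \<Rightarrow> nat) \<Rightarrow> complex) set)"
    using dense_ell[OF p s(1) less_imp_le[OF s(2)]] by blast
  show "finite_support \<subseteq> topspace (ell p s :: (('d \<Rightarrow> nat) \<Rightarrow> complex) topology)"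
    unfolding top using finite_support_weighted_lp[OF p, of _ "weight 1 s"] zero_less_one by blast
  show "coef (Op_V a (series_of_coef c)) = kernel_op ?K c" if "c \<in> finite_support" for c
    using that by (rule coef_Op_V)
  show "Hausdorff_space (ell_dual p s :: (('d \<Rightarrow> nat) \<Rightarrow> complex) topology)"
    by (rule Hausdorff_ell_dual[OF p s0])
qed

text \<open>The single \<rho> of the symbol yields a single r, and the operator factors through one
  weighted space on each side. The inductive limit topology of the target is entered only by the
  continuous inclusion of a step.\<close>

lemma extends_uniquely_A0:
  fixes a :: "'d::finite sesqui_series"
  assumes p: "1 \<le> p" and s: "s \<in> R_flat" "s \<le> Num (1/2)" and a: "a \<in> topspace (A0_tilde_dual p s)"
  shows "extends_uniquely (Op_V a) (topspace (A_space p (Num 0))) (A0_space p s) (A0_dual p s)"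
  unfolding topspace_A_space_zero unfolding A0_space_def A0_dual_def
proof (rule extends_uniquely_pullback_coef)
  let ?K = "kernel_coef a"
  obtain \<rho> where \<rho>: "0 < \<rho>" and ca: "in_lp p (\<lambda>\<eta>. coef2_seq a \<eta> * of_real (1 / weight \<rho> s \<eta>))"
    using a unfolding A0_tilde_dual_def topspace_pullback_topology topspace_ell0_dual by blast
  obtain A where A: "0 \<le> A" "\<And>\<alpha> \<beta>. norm (coef2 a \<alpha> \<beta>) \<le> A * weight \<rho> s (case_sum \<alpha> \<beta>)"
    using coef2_weight_bound[OF p \<rho> ca] by metis
  obtain r where r: "0 < r"
    and w: "\<And>\<alpha> \<beta> \<gamma> :: 'd \<Rightarrow> nat. \<gamma> \<le> \<alpha> \<Longrightarrow> \<gamma> \<le> \<beta> \<Longrightarrow>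
      8 ^ (mlen \<alpha> + mlen \<beta>) * weight \<rho> s (case_sum (\<alpha> - \<gamma>) (\<beta> - \<gamma>))
        \<le> weight r s \<alpha> * weight r s \<beta>"
    using weight_growth_large[OF s \<rho>] by metis
  have bound: "norm (?K \<alpha> \<beta>) \<le> A * ((1/2) ^ mlen \<alpha> * weight r s \<alpha>) * ((1/2) ^ mlen \<beta> * weight r s \<beta>)"
    for \<alpha> \<beta>
  proof -
    have "norm (?K \<alpha> \<beta>) \<le> A * 1 * ((1/2) ^ mlen \<alpha> * weight r s \<alpha>) * ((1/2) ^ mlen \<beta> * weight r s \<beta>)"
      using w by (intro kernel_coef_weight_le[OF A(2,1) _ r]) (simp_all del: weight.simps)
    then show ?thesis by (simp only: mult_1_right)
  qed
  note wp = weight_pos[OF r]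
  let ?\<X> = "{weighted_lp p (\<lambda>\<alpha> :: 'd \<Rightarrow> nat. 1 / weight r s \<alpha>) | r. 0 < r}"
  have "continuous_map (ell0 p s) (weighted_lp p (weight r s :: ('d \<Rightarrow> nat) \<Rightarrow> real)) (\<lambda>c. c)"
    unfolding ell0_def using r by (intro continuous_map_from_proj_limit) blast
  moreover have "continuous_map (weighted_lp p (weight r s)) (weighted_lp p (\<lambda>\<alpha>. 1 / weight r s \<alpha>)) (kernel_op ?K)"
    by (rule continuous_map_kernel_op[OF p A(1) wp wp bound])
  moreover have "continuous_map (weighted_lp p (\<lambda>\<alpha>. 1 / weight r s \<alpha>)) (ell0_dual p s) (\<lambda>c :: ('d \<Rightarrow> nat) \<Rightarrow> complex. c)"
  proof -
    have "weighted_lp p (\<lambda>\<alpha> :: 'd \<Rightarrow> nat. 1 / weight r s \<alpha>) \<in> ?\<X>" using r by blast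
    then show ?thesis
      using continuous_map_into_ind_limit[OF seminorm_on_weighted_lp[OF p], of _ ?\<X>]
        topspace_ell0_dual_Union[of p s]
      unfolding weighted_lp_def[symmetric] ell0_dual_def by blast
  qed
  ultimately have "continuous_map (ell0 p s) (ell0_dual p s) ((\<lambda>c. c) \<circ> (kernel_op ?K \<circ> (\<lambda>c. c)))"
    by (blast intro: continuous_map_compose)
  then show "continuous_map (ell0 p s) (ell0_dual p s) (kernel_op ?K)" by (simp add: comp_def)
  show "lin_on (topspace (ell0 p s)) (kernel_op ?K)"
  proof (rule lin_on_kernel_op)
    fix c \<alpha> assume "c \<in> topspace (ell0 p s :: (('d \<Rightarrow> nat) \<Rightarrow> complex) topology)"
    then have c: "in_lp p (\<lambda>\<alpha>. c \<alpha> * of_real (weight r s \<alpha>))"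
      using topspace_ell0 r by blast
    show "(\<lambda>\<beta>. ?K \<alpha> \<beta> * c \<beta>) summable_on UNIV"
      by (rule kernel_op_summable[OF p A(1) wp wp bound c])
  qed
  show "lin_closed (topspace (ell0 p s :: (('d \<Rightarrow> nat) \<Rightarrow> complex) topology))"
    by (rule lin_closed_ell0)
  show "topspace (ell0 p s) \<subseteq> ell0 p s closure_of (finite_support :: (('d \<Rightarrow> nat) \<Rightarrow> complex) set)"
    using dense_ell0[OF p s] by blast
  show "finite_support \<subseteq> topspace (ell0 p s :: (('d \<Rightarrow> nat) \<Rightarrow> complex) topology)"
    using finite_support_weighted_lp[OF p] unfolding topspace_ell0 topspace_weighted_lp by blast
  show "coef (Op_V a (series_of_coef c)) = kernel_op ?K c" if "c \<in> finite_support" for c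
    using that by (rule coef_Op_V)
  show "Hausdorff_space (ell0_dual p s :: (('d \<Rightarrow> nat) \<Rightarrow> complex) topology)"
    by (rule Hausdorff_ell0_dual[OF p])
qed

theorem theorem3p8:
  fixes a :: "'d::finite sesqui_series" and p :: ennreal
  assumes "1 \<le> p"
    and "a \<in> topspace (A_tilde_dual p (Num 0))"
  shows "(\<forall>s\<in>R_flat0. s < Num (1/2) \<longrightarrow> a \<in> topspace (A_tilde_dual p s) \<longrightarrow>
            extends_uniquely (Op_V a) (topspace (A_space p (Num 0))) (A_space p s) (A_dual p s)) \<and>
         (\<forall>s\<in>R_flat. s \<le> Num (1/2) \<longrightarrow> a \<in> topspace (A0_tilde_dual p s) \<longrightarrow>
            extends_uniquely (Op_V a) (topspace (A_space p (Num 0))) (A0_space p s) (A0_dual p s))"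
  using extends_uniquely_zero[OF assms(1)] extends_uniquely_A[OF assms(1)] extends_uniquely_A0[OF assms(1)]
  unfolding R_flat0_def by blast

end
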